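(* Let $n\ge 1$, let $0<r_j<\infty$ and $0<s_j<\infty$ for $j=1,\dots,n$, let $\mathbf{u}_1,\mathbf{u}_2\in\mathbb{C}^n$, and let $$\rho=W(\mathbf{u}_1)\gamma(\mathbf{r})W(\mathbf{u}_1)^{\dagger},\qquad \sigma=W(\mathbf{u}_2)\gamma(\mathbf{s})W(\mathbf{u}_2)^{\dagger},$$ where $\gamma(\mathbf{r})=\otimes_{j=1}^n\gamma(r_j)$ and $\gamma(\mathbf{s})=\otimes_{j=1}^n\gamma(s_j)$. Then for $\alpha\in(0,1)\cup(1,\infty)$, $$D_\alpha(\rho\|\sigma)<\infty \iff \alpha<\min\left\{\frac{s_j}{s_j-r_j} : j\in\{1,\dots,n\} \text{ such that } r_j<s_j\right\},$$ where the minimum of the empty set is taken to be $+\infty$.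
   Context: One-mode Fock space: $\ell^2(\mathbb{Z}_{\ge 0})$ with orthonormal particle (number) basis $\{|k\rangle\}_{k\ge0}$; the $n$-mode space is the $n$-fold tensor product with basis $|\mathbf{k}\rangle=|k_1\rangle\otimes\cdots\otimes|k_n\rangle$. For $0<s<\infty$ the one-mode thermal state is $\gamma(s)=(1-e^{-s})\sum_{k\ge0}e^{-ks}|k\rangle\langle k|$, and $\gamma(\infty)=|0\rangle\langle 0|$. For $u\in\mathbb{C}$ the exponential vector is $|e(v)\rangle=\sum_{k\ge0}\frac{v^k}{\sqrt{k!}}|k\rangle$, and the one-mode Weyl (displacement) unitary $W(u)$ is the unique unitary with $W(u)|e(v)\rangle=\exp(-\tfrac12|u|^2-\bar u v)|e(u+v)\rangle$ for all $v\in\mathbb{C}$; for $\mathbf{u}=(u_1,\dots,u_n)\in\mathbb{C}^n$, $W(\mathbf{u})=W(u_1)\otimes\cdots\otimes W(u_n)$. For states $\rho=\sum_i p_i|x_i\rangle\langle x_i|$, $\sigma=\sum_j q_j|y_j\rangle\langle y_j|$ (spectral decompositions with orthonormal bases $\{x_i\}$, $\{y_j\}$), the Petz–Rényi $\alpha$-relative entropy for $\alpha\in(0,1)\cup(1,\infty)$ is $D_\alpha(\rho\|\sigma)=\frac{1}{\alpha-1}\log\sum_{i,j}p_i^\alpha q_j^{1-\alpha}|\langle x_i|y_j\rangle|^2$, with the conventions (for $\alpha>1$) $0^{1-\alpha}=\infty$ and $0\cdot\infty=0$. *)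

theory Defs
  imports "HOL-Analysis.Analysis" "HOL-Library.FuncSet"
begin

definition l2 :: "(nat \<Rightarrow> complex) \<Rightarrow> bool" where
  "l2 f \<longleftrightarrow> summable (\<lambda>k. (cmod (f k))^2)"

definition l2_inner :: "(nat \<Rightarrow> complex) \<Rightarrow> (nat \<Rightarrow> complex) \<Rightarrow> complex" where
  "l2_inner f g = (\<Sum>k. cnj (f k) * g k)"

definition ket :: "nat \<Rightarrow> nat \<Rightarrow> complex" where
  "ket k = (\<lambda>i. if i = k then 1 else 0)"

definition expvec :: "complex \<Rightarrow> nat \<Rightarrow> complex" where
  "expvec v = (\<lambda>k. v ^ k / complex_of_real (sqrt (fact k)))"

text \<open>unitary operators on l2 (normalised to be 0 off l2, so that they are determined
  by their action on l2)\<close>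
definition is_unitary :: "((nat \<Rightarrow> complex) \<Rightarrow> (nat \<Rightarrow> complex)) \<Rightarrow> bool" where
  "is_unitary U \<longleftrightarrow>
     (\<forall>f. l2 f \<longrightarrow> l2 (U f)) \<and>
     (\<forall>a b f g. l2 f \<longrightarrow> l2 g \<longrightarrow> U (\<lambda>k. a * f k + b * g k) = (\<lambda>k. a * U f k + b * U g k)) \<and>
     (\<forall>f g. l2 f \<longrightarrow> l2 g \<longrightarrow> l2_inner (U f) (U g) = l2_inner f g) \<and>
     (\<forall>g. l2 g \<longrightarrow> (\<exists>f. l2 f \<and> U f = g)) \<and>
     (\<forall>f. \<not> l2 f \<longrightarrow> U f = (\<lambda>_. 0))"

definition weyl :: "complex \<Rightarrow> (nat \<Rightarrow> complex) \<Rightarrow> (nat \<Rightarrow> complex)" where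
  "weyl u = (THE U. is_unitary U \<and>
      (\<forall>v. U (expvec v) = (\<lambda>k. exp (- complex_of_real ((cmod u)^2 / 2) - cnj u * v) * expvec (u + v) k)))"

definition idx :: "nat \<Rightarrow> (nat \<Rightarrow> nat) set" where
  "idx n = Pi\<^sub>E {..<n} (\<lambda>_. UNIV)"

definition inner_n :: "nat \<Rightarrow> ((nat \<Rightarrow> nat) \<Rightarrow> complex) \<Rightarrow> ((nat \<Rightarrow> nat) \<Rightarrow> complex) \<Rightarrow> complex" where
  "inner_n n f g = infsum (\<lambda>i. cnj (f i) * g i) (idx n)"

definition tensor :: "nat \<Rightarrow> (nat \<Rightarrow> nat \<Rightarrow> complex) \<Rightarrow> (nat \<Rightarrow> nat) \<Rightarrow> complex" where
  "tensor n \<phi> = (\<lambda>i. \<Prod>j<n. \<phi> j (i j))"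

definition weyl_ket :: "nat \<Rightarrow> (nat \<Rightarrow> complex) \<Rightarrow> (nat \<Rightarrow> nat) \<Rightarrow> (nat \<Rightarrow> nat) \<Rightarrow> complex" where
  "weyl_ket n u k = tensor n (\<lambda>j. weyl (u j) (ket (k j)))"

text \<open>eigenvalue of gamma(r) = (x)_j gamma(r_j) on |k>\<close>
definition thermal_eig :: "nat \<Rightarrow> (nat \<Rightarrow> real) \<Rightarrow> (nat \<Rightarrow> nat) \<Rightarrow> real" where
  "thermal_eig n r k = (\<Prod>j<n. (1 - exp (- r j)) * exp (- real (k j) * r j))"

definition eln :: "ennreal \<Rightarrow> ereal" where
  "eln x = (if x = 0 then -\<infinity> else if x = top then \<infinity> else ereal (ln (enn2real x)))"

text \<open>p, q: eigenvalues indexed by I, J; ov i j = <x_i|y_j>.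
  Conventions: 0 powr (1 - alpha) = infinity for alpha > 1, and 0 * infinity = 0 (as in ennreal).\<close>
definition petz_renyi :: "real \<Rightarrow> 'i set \<Rightarrow> ('i \<Rightarrow> real) \<Rightarrow> 'j set \<Rightarrow> ('j \<Rightarrow> real)
    \<Rightarrow> ('i \<Rightarrow> 'j \<Rightarrow> complex) \<Rightarrow> ereal" where
  "petz_renyi \<alpha> I p J q ov =
     eln (infsum (\<lambda>(i, j). ennreal (p i powr \<alpha>)
             * (if 1 < \<alpha> \<and> q j = 0 then top else ennreal (q j powr (1 - \<alpha>)))
             * ennreal ((cmod (ov i j))^2)) (I \<times> J))
     * ereal (1 / (\<alpha> - 1))"

end

theory Submission
  imports Defs
begin

text \<open>The sum defining the relative entropy is a product over the modes. In one mode, writing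
  \<open>w = u\<^sub>2 - u\<^sub>1\<close>, \<open>a = \<alpha> r\<close>, \<open>b = (\<alpha> - 1) s\<close>, it is a positive multiple of
  \<open>\<Sum> exp (- a k) exp (b m) |<k|W(w)|m>|\<^sup>2\<close>, and the claim for \<open>\<alpha> > 1\<close> is that this converges iff
  \<open>b < a\<close>. The distribution of \<open>k\<close> in the state \<open>W(w)|m>\<close> has mean \<open>m + |w|\<^sup>2\<close>, so by Jensen's
  inequality the \<open>m\<close>-th column contributes at least \<open>exp ((b - a) m - a |w|\<^sup>2)\<close>, which excludes
  \<open>b \<ge> a\<close>. Conversely, bounding the matrix coefficients by their generating function
  (a Cauchy estimate at radius of order \<open>sqrt m\<close>) shows that the column is at most
  \<open>exp ((b - a) m + O(sqrt m))\<close>. The Weyl operator itself is obtained from its matrix, whose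
  unitarity follows from the commutation relations with the ladder operators, and it is
  unique because exponential vectors separate points. For \<open>\<alpha> < 1\<close> both sides hold.\<close>

section \<open>Matrices with orthonormal columns and rows\<close>

lemma l2_mult_summable:
  assumes "l2 f" "l2 g"
  shows "summable (\<lambda>k. norm (f k * g k))"
proof (rule summable_comparison_test')
  show "summable (\<lambda>k. (cmod (f k))\<^sup>2 + (cmod (g k))\<^sup>2)"
    using assms by (auto simp: l2_def intro: summable_add)
  fix k :: nat
  have "2 * cmod (f k) * cmod (g k) \<le> (cmod (f k))\<^sup>2 + (cmod (g k))\<^sup>2"
    by (rule sum_squares_bound)
  moreover have "0 \<le> cmod (f k) * cmod (g k)" by simp
  ultimately have "cmod (f k) * cmod (g k) \<le> (cmod (f k))\<^sup>2 + (cmod (g k))\<^sup>2" by linarith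
  then show "norm (norm (f k * g k)) \<le> (cmod (f k))\<^sup>2 + (cmod (g k))\<^sup>2"
    by (simp add: norm_mult)
qed

lemma l2_cnj [simp]: "l2 (\<lambda>k. cnj (f k)) \<longleftrightarrow> l2 f"
  by (simp add: l2_def)

lemma l2_cmult: "l2 f \<Longrightarrow> l2 (\<lambda>k. a * f k)"
  by (auto simp: l2_def norm_mult power_mult_distrib intro: summable_mult)

lemma l2_add:
  assumes "l2 f" "l2 g"
  shows "l2 (\<lambda>k. f k + g k)"
  unfolding l2_def
proof (rule summable_comparison_test')
  show "summable (\<lambda>k. 2 * ((cmod (f k))\<^sup>2 + (cmod (g k))\<^sup>2))"
    using assms by (auto simp: l2_def intro!: summable_add summable_mult)
  fix k :: nat
  have "(cmod (f k + g k))\<^sup>2 \<le> (cmod (f k) + cmod (g k))\<^sup>2"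
    by (intro power_mono norm_triangle_ineq) auto
  also have "\<dots> \<le> 2 * ((cmod (f k))\<^sup>2 + (cmod (g k))\<^sup>2)"
    using sum_squares_bound[of "cmod (f k)" "cmod (g k)"] by (simp add: power2_sum)
  finally show "norm ((cmod (f k + g k))\<^sup>2) \<le> 2 * ((cmod (f k))\<^sup>2 + (cmod (g k))\<^sup>2)"
    by simp
qed

lemma l2_ket [simp]: "l2 (ket m)"
  unfolding l2_def by (rule summable_finite[of "{m}"]) (auto simp: ket_def)

lemma l2_Cauchy_Schwarz:
  assumes "l2 f" "l2 g"
  shows "cmod (\<Sum>k. f k * g k) \<le> sqrt (\<Sum>k. (cmod (f k))\<^sup>2) * sqrt (\<Sum>k. (cmod (g k))\<^sup>2)"
proof -
  have "cmod (\<Sum>k. f k * g k) \<le> (\<Sum>k. norm (f k * g k))"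
    by (rule summable_norm[OF l2_mult_summable[OF assms]])
  also have "\<dots> \<le> sqrt (\<Sum>k. (cmod (f k))\<^sup>2) * sqrt (\<Sum>k. (cmod (g k))\<^sup>2)"
  proof (rule suminf_le_const[OF l2_mult_summable[OF assms]])
    fix N
    have "(\<Sum>k<N. norm (f k * g k)) = (\<Sum>k<N. \<bar>cmod (f k)\<bar> * \<bar>cmod (g k)\<bar>)"
      by (simp add: norm_mult)
    also have "\<dots> \<le> L2_set (\<lambda>k. cmod (f k)) {..<N} * L2_set (\<lambda>k. cmod (g k)) {..<N}"
      by (rule L2_set_mult_ineq)
    also have "\<dots> \<le> sqrt (\<Sum>k. (cmod (f k))\<^sup>2) * sqrt (\<Sum>k. (cmod (g k))\<^sup>2)"
      unfolding L2_set_def using assms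
      by (intro mult_mono real_sqrt_le_mono sum_le_suminf) (auto simp: l2_def sum_nonneg suminf_nonneg)
    finally show "(\<Sum>k<N. norm (f k * g k)) \<le> sqrt (\<Sum>k. (cmod (f k))\<^sup>2) * sqrt (\<Sum>k. (cmod (g k))\<^sup>2)" .
  qed
  finally show ?thesis .
qed

section \<open>Operators given by infinite matrices\<close>

definition matop :: "(nat \<Rightarrow> nat \<Rightarrow> complex) \<Rightarrow> (nat \<Rightarrow> complex) \<Rightarrow> nat \<Rightarrow> complex" where
  "matop W f = (\<lambda>k. \<Sum>m. W k m * f m)"

text \<open>Besides orthonormal columns, square-summable rows are demanded, so that the series in
  \<open>matop\<close> converge on \<open>l2\<close> arguments.\<close>

definition isometric_matrix :: "(nat \<Rightarrow> nat \<Rightarrow> complex) \<Rightarrow> bool" where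
  "isometric_matrix W \<longleftrightarrow> (\<forall>k. l2 (W k)) \<and>
     (\<forall>m l. (\<lambda>k. cnj (W k m) * W k l) sums (if m = l then 1 else 0))"

lemma isometric_matrix_row: "isometric_matrix W \<Longrightarrow> l2 (W k)"
  by (simp add: isometric_matrix_def)

lemma isometric_matrix_cols:
  "isometric_matrix W \<Longrightarrow> (\<lambda>k. cnj (W k m) * W k l) sums (if m = l then 1 else 0)"
  by (simp add: isometric_matrix_def)

lemma l2_if_sums:
  assumes "(\<lambda>k. cnj (f k) * f k) sums c"
  shows "l2 f"
proof -
  have "(\<lambda>k. Re (cnj (f k) * f k)) sums Re c"
    using assms by (rule sums_Re)
  moreover have "Re (cnj (f k) * f k) = (cmod (f k))\<^sup>2" for k
    by (simp add: cmod_power2 flip: power2_eq_square)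
  ultimately show ?thesis by (simp add: l2_def sums_iff)
qed

lemma isometric_matrix_col: "isometric_matrix W \<Longrightarrow> l2 (\<lambda>k. W k m)"
  by (rule l2_if_sums[OF isometric_matrix_cols[of W m m]])

text \<open>Pythagoras: the square is expanded into a finite double sum, and each term is summed
  over \<open>k\<close> by orthonormality.\<close>

lemma isometric_matrix_norm_finite:
  assumes W: "isometric_matrix W"
  shows "(\<lambda>k. (cmod (\<Sum>m<N. W k m * f m))\<^sup>2) sums (\<Sum>m<N. (cmod (f m))\<^sup>2)"
proof -
  have "(\<lambda>k. \<Sum>m<N. \<Sum>l<N. (cnj (f m) * f l) * (cnj (W k m) * W k l)) sums
        (\<Sum>m<N. \<Sum>l<N. (cnj (f m) * f l) * (if m = l then 1 else 0))"
    by (intro sums_sum sums_mult isometric_matrix_cols[OF W])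
  also have "(\<lambda>k. \<Sum>m<N. \<Sum>l<N. (cnj (f m) * f l) * (cnj (W k m) * W k l)) =
             (\<lambda>k. complex_of_real ((cmod (\<Sum>m<N. W k m * f m))\<^sup>2))"
    by (rule ext, subst sum.swap) (simp add: complex_norm_square sum_product mult_ac del: of_real_power)
  also have "(\<Sum>m<N. \<Sum>l<N. (cnj (f m) * f l) * (if m = l then 1 else 0)) =
             complex_of_real (\<Sum>m<N. (cmod (f m))\<^sup>2)"
    by (simp add: complex_norm_square if_distrib mult_ac cong: if_cong del: of_real_power)
  finally show ?thesis by (simp only: sums_of_real_iff)
qed

text \<open>Fatou-type limit: a finite block of coordinates is the limit of the blocks for
  truncations of \<open>f\<close>, whose image norms are known exactly. Equality of norms comes only
  with \<open>l2_inner_matop_matop\<close>.\<close>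

lemma isometric_matrix_bounded:
  assumes W: "isometric_matrix W" and f: "l2 f"
  shows "l2 (matop W f)" "(\<Sum>k. (cmod (matop W f k))\<^sup>2) \<le> (\<Sum>k. (cmod (f k))\<^sup>2)"
proof -
  have lim: "(\<lambda>N. \<Sum>m<N. W k m * f m) \<longlonglongrightarrow> matop W f k" for k
    unfolding matop_def
    by (intro summable_LIMSEQ summable_norm_cancel[OF l2_mult_summable] isometric_matrix_row[OF W] f)
  have le: "(\<Sum>k<K. (cmod (matop W f k))\<^sup>2) \<le> (\<Sum>k. (cmod (f k))\<^sup>2)" for K
  proof (rule LIMSEQ_le_const2)
    show "(\<lambda>N. \<Sum>k<K. (cmod (\<Sum>m<N. W k m * f m))\<^sup>2) \<longlonglongrightarrow> (\<Sum>k<K. (cmod (matop W f k))\<^sup>2)"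
      by (intro tendsto_intros lim)
    have "(\<Sum>k<K. (cmod (\<Sum>m<N. W k m * f m))\<^sup>2) \<le> (\<Sum>k. (cmod (f k))\<^sup>2)" for N
    proof -
      note s = isometric_matrix_norm_finite[OF W, where N = N and f = f]
      have "(\<Sum>k<K. (cmod (\<Sum>m<N. W k m * f m))\<^sup>2) \<le> (\<Sum>k. (cmod (\<Sum>m<N. W k m * f m))\<^sup>2)"
        by (rule sum_le_suminf) (use s in \<open>auto simp: sums_iff\<close>)
      also have "\<dots> = (\<Sum>m<N. (cmod (f m))\<^sup>2)"
        using s by (simp add: sums_iff)
      also have "\<dots> \<le> (\<Sum>k. (cmod (f k))\<^sup>2)"
        by (rule sum_le_suminf) (use f in \<open>auto simp: l2_def\<close>)
      finally show ?thesis .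
    qed
    then show "\<exists>N. \<forall>n\<ge>N. (\<Sum>k<K. (cmod (\<Sum>m<n. W k m * f m))\<^sup>2) \<le> (\<Sum>k. (cmod (f k))\<^sup>2)" by blast
  qed
  show "l2 (matop W f)" unfolding l2_def
    by (rule bounded_imp_summable[of _ "\<Sum>k. (cmod (f k))\<^sup>2"])
       (use le[of "Suc _"] in \<open>auto simp: lessThan_Suc_atMost\<close>)
  then show "(\<Sum>k. (cmod (matop W f k))\<^sup>2) \<le> (\<Sum>k. (cmod (f k))\<^sup>2)"
    unfolding l2_def by (rule suminf_le_const) (rule le)
qed

lemma matop_linear:
  assumes "isometric_matrix W" "l2 f" "l2 g"
  shows "matop W (\<lambda>k. a * f k + b * g k) = (\<lambda>k. a * matop W f k + b * matop W g k)"
proof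
  fix k
  have s: "summable (\<lambda>m. W k m * h m)" if "l2 h" for h
    by (intro summable_norm_cancel[OF l2_mult_summable] isometric_matrix_row[OF assms(1)] that)
  have "matop W (\<lambda>k. a * f k + b * g k) k = (\<Sum>m. a * (W k m * f m) + b * (W k m * g m))"
    by (simp add: matop_def algebra_simps)
  also have "\<dots> = a * matop W f k + b * matop W g k"
    unfolding matop_def
    by (subst suminf_add[symmetric]) (auto intro: summable_mult s assms simp: suminf_mult s assms)
  finally show "matop W (\<lambda>k. a * f k + b * g k) k = a * matop W f k + b * matop W g k" .
qed

text \<open>Interchange of the sums over \<open>k\<close> and \<open>m\<close>. The double series
  need not converge absolutely; instead, the error after \<open>N\<close> columns is the pairing of
  \<open>h\<close> with the image of the tail of \<open>f\<close>, which tends to 0 by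
  Cauchy-Schwarz and contractivity.\<close>

lemma l2_inner_matop:
  assumes W: "isometric_matrix W" and h: "l2 h" and f: "l2 f"
  shows "(\<lambda>m. f m * l2_inner h (\<lambda>k. W k m)) sums l2_inner h (matop W f)"
proof -
  define tail where "tail N m = (if m < N then 0 else f m)" for N m
  have tail_l2: "l2 (tail N)" for N
    unfolding l2_def tail_def
    by (rule summable_comparison_test'[of "\<lambda>k. (cmod (f k))\<^sup>2" 0]) (use f in \<open>auto simp: l2_def\<close>)
  have tail_norm: "(\<Sum>k. (cmod (tail N k))\<^sup>2) = (\<Sum>k. (cmod (f k))\<^sup>2) - (\<Sum>k<N. (cmod (f k))\<^sup>2)" for N
  proof -
    have "(\<Sum>k. (cmod (tail N k))\<^sup>2) = (\<Sum>k. (cmod (f k))\<^sup>2 - (if k \<in> {..<N} then (cmod (f k))\<^sup>2 else 0))"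
      by (rule arg_cong[where f = suminf]) (auto simp: tail_def)
    also have "\<dots> = (\<Sum>k. (cmod (f k))\<^sup>2) - (\<Sum>k<N. (cmod (f k))\<^sup>2)"
      using sums_If_finite_set[of "{..<N}" "\<lambda>k. (cmod (f k))\<^sup>2"] f
      by (subst suminf_diff[symmetric]) (auto simp: sums_iff l2_def)
    finally show ?thesis .
  qed
  have split: "l2_inner h (matop W f) - (\<Sum>m<N. f m * l2_inner h (\<lambda>k. W k m)) = (\<Sum>k. cnj (h k) * matop W (tail N) k)" for N
  proof -
    have mt: "matop W (tail N) k = matop W f k - (\<Sum>m<N. W k m * f m)" for k
    proof -
      have "matop W (tail N) k = (\<Sum>m. W k m * f m - (if m \<in> {..<N} then W k m * f m else 0))"
        unfolding matop_def by (rule arg_cong[where f = suminf]) (auto simp: tail_def)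
      also have "\<dots> = matop W f k - (\<Sum>m<N. W k m * f m)"
        using sums_If_finite_set[of "{..<N}" "\<lambda>m. W k m * f m"]
          summable_norm_cancel[OF l2_mult_summable[OF isometric_matrix_row[OF W, of k] f]]
        unfolding matop_def by (subst suminf_diff[symmetric]) (auto simp: sums_iff)
      finally show ?thesis .
    qed
    have s1: "summable (\<lambda>k. cnj (h k) * matop W f k)"
      by (intro summable_norm_cancel[OF l2_mult_summable] isometric_matrix_bounded[OF W f]) (simp add: h)
    have "(\<lambda>k. \<Sum>m<N. f m * (cnj (h k) * W k m)) sums (\<Sum>m<N. f m * l2_inner h (\<lambda>k. W k m))"
      unfolding l2_inner_def
      by (intro sums_sum sums_mult summable_sums summable_norm_cancel[OF l2_mult_summable]
           isometric_matrix_col[OF W]) (simp add: h)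
    from sums_diff[OF summable_sums[OF s1] this] show ?thesis
      by (simp add: l2_inner_def sums_iff mt algebra_simps sum_distrib_left)
  qed
  define E where "E N = sqrt (\<Sum>k. (cmod (h k))\<^sup>2) * sqrt ((\<Sum>k. (cmod (f k))\<^sup>2) - (\<Sum>k<N. (cmod (f k))\<^sup>2))" for N
  have "(\<lambda>N. l2_inner h (matop W f) - (\<Sum>m<N. f m * l2_inner h (\<lambda>k. W k m))) \<longlonglongrightarrow> 0"
  proof (rule Lim_null_comparison)
    show "\<forall>\<^sub>F N in sequentially. norm (l2_inner h (matop W f) - (\<Sum>m<N. f m * l2_inner h (\<lambda>k. W k m))) \<le> E N"
    proof (intro always_eventually allI)
      fix N
      have "cmod (\<Sum>k. cnj (h k) * matop W (tail N) k)
          \<le> sqrt (\<Sum>k. (cmod (cnj (h k)))\<^sup>2) * sqrt (\<Sum>k. (cmod (matop W (tail N) k))\<^sup>2)"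
        by (rule l2_Cauchy_Schwarz) (simp_all add: h isometric_matrix_bounded[OF W tail_l2])
      also have "\<dots> \<le> E N"
        unfolding E_def tail_norm[symmetric]
        using h by (auto simp: l2_def intro!: mult_left_mono isometric_matrix_bounded[OF W tail_l2] suminf_nonneg)
      finally show "norm (l2_inner h (matop W f) - (\<Sum>m<N. f m * l2_inner h (\<lambda>k. W k m))) \<le> E N"
        by (simp add: split)
    qed
    have "(\<lambda>N. \<Sum>k<N. (cmod (f k))\<^sup>2) \<longlonglongrightarrow> (\<Sum>k. (cmod (f k))\<^sup>2)"
      using f by (intro summable_LIMSEQ) (simp add: l2_def)
    then have "E \<longlonglongrightarrow> sqrt (\<Sum>k. (cmod (h k))\<^sup>2) * sqrt ((\<Sum>k. (cmod (f k))\<^sup>2) - (\<Sum>k. (cmod (f k))\<^sup>2))"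
      unfolding E_def by (intro tendsto_intros)
    then show "E \<longlonglongrightarrow> 0" by simp
  qed
  from tendsto_diff[OF tendsto_const[of "l2_inner h (matop W f)"] this] show ?thesis
    by (simp add: sums_def)
qed

text \<open>The adjoint is a left inverse: with a column as \<open>h\<close>, orthonormality
  collapses the interchanged series to one term.\<close>

lemma matop_adjoint_matop:
  assumes W: "isometric_matrix W" and f: "l2 f"
  shows "l2_inner (\<lambda>k. W k l) (matop W f) = f l"
proof -
  have eq: "l2_inner (\<lambda>k. W k l) (\<lambda>k. W k m) = (if m = l then 1 else 0)" for m
    using isometric_matrix_cols[OF W, of l m] by (auto simp: l2_inner_def sums_iff)
  have "(\<lambda>m. f m * (if m = l then 1 else 0)) sums l2_inner (\<lambda>k. W k l) (matop W f)"
    using l2_inner_matop[OF W isometric_matrix_col[OF W, of l] f] by (simp add: eq)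
  moreover have "(\<lambda>m. f m * (if m = l then 1 else 0)) sums f l"
    using sums_single[of l f] by (simp add: if_distrib eq_commute cong: if_cong)
  ultimately show ?thesis by (rule sums_unique2)
qed

lemma l2_inner_matop_matop:
  assumes W: "isometric_matrix W" and f: "l2 f" and g: "l2 g"
  shows "l2_inner (matop W f) (matop W g) = l2_inner f g"
proof -
  have "l2_inner (matop W f) (\<lambda>k. W k m) = cnj (l2_inner (\<lambda>k. W k m) (matop W f))" for m
  proof -
    have "summable (\<lambda>k. cnj (W k m) * matop W f k)"
      by (intro summable_norm_cancel[OF l2_mult_summable] isometric_matrix_bounded[OF W f])
         (simp add: isometric_matrix_col[OF W])
    then have "(\<lambda>k. cnj (cnj (W k m) * matop W f k)) sums cnj (l2_inner (\<lambda>k. W k m) (matop W f))"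
      unfolding l2_inner_def sums_cnj by (rule summable_sums)
    then show ?thesis by (simp add: l2_inner_def sums_iff mult.commute)
  qed
  then have "(\<lambda>m. g m * cnj (f m)) sums l2_inner (matop W f) (matop W g)"
    using l2_inner_matop[OF W isometric_matrix_bounded(1)[OF W f] g] by (simp add: matop_adjoint_matop[OF W f])
  then show ?thesis by (simp add: l2_inner_def sums_iff mult.commute)
qed

lemma is_unitary_matop:
  assumes W: "isometric_matrix W" and W': "isometric_matrix (\<lambda>m k. cnj (W k m))"
  shows "is_unitary (\<lambda>f. if l2 f then matop W f else (\<lambda>_. 0))"
proof -
  have "\<exists>f. l2 f \<and> matop W f = g" if g: "l2 g" for g
  proof (intro exI conjI)
    show "l2 (matop (\<lambda>m k. cnj (W k m)) g)"
      by (rule isometric_matrix_bounded(1)[OF W' g])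
    \<comment> \<open>The left-inverse identity for the conjugate transpose, whose own adjoint is
      \<open>W\<close>.\<close>
    show "matop W (matop (\<lambda>m k. cnj (W k m)) g) = g"
      using matop_adjoint_matop[OF W' g] by (intro ext) (simp add: l2_inner_def matop_def)
  qed
  then show ?thesis
    unfolding is_unitary_def
    using isometric_matrix_bounded(1)[OF W] matop_linear[OF W] l2_inner_matop_matop[OF W]
    by (auto simp: l2_add l2_cmult)
qed

section \<open>Matrix coefficients of displacement operators\<close>

text \<open>Up to the factor \<open>exp (- |u|^2 / 2)\<close>, \<open>disp u (- cnj u) m\<close> is the vector \<open>W(u)|m>\<close>.
  The recursion in \<open>m\<close> expresses \<open>W(u) a\<^sup>\<dagger> = (a\<^sup>\<dagger> - cnj u) W(u)\<close>, where
  \<open>a\<^sup>\<dagger>|k> = sqrt (k + 1)|k + 1>\<close>; at \<open>k = 0\<close> the truncated index \<open>k - 1\<close> is harmless because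
  its coefficient \<open>sqrt k\<close> vanishes. Two independent parameters make the family closed under
  transposition, conjugation and the pairing below.\<close>

primrec disp :: "'a \<Rightarrow> 'a \<Rightarrow> nat \<Rightarrow> nat \<Rightarrow> 'a::real_normed_field" where
  "disp p q 0 = (\<lambda>k. p ^ k / of_real (sqrt (fact k)))"
| "disp p q (Suc m) =
     (\<lambda>k. (of_real (sqrt (real k)) * disp p q m (k - 1) + q * disp p q m k) / of_real (sqrt (real (Suc m))))"

declare disp.simps(2) [simp del]

lemma of_real_sqrt_mult_self [simp]:
  "of_real (sqrt (real k)) * (of_real (sqrt (real k)) :: 'a::real_normed_field) = of_nat k"
  by (simp flip: of_real_mult)

lemma of_real_sqrt_mult_self_left [simp]:
  "of_real (sqrt (real k)) * (of_real (sqrt (real k)) * x) = of_nat k * (x :: 'a::real_normed_field)"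
  by (simp flip: mult.assoc)

section \<open>Ladder relations, symmetries and the generating function\<close>

lemma disp_up:
  "of_real (sqrt (real (Suc m))) * disp p q (Suc m) k = of_real (sqrt (real k)) * disp p q m (k - 1) + q * disp p q m k"
  by (simp add: disp.simps(2))

text \<open>The annihilation relation a W(u) = W(u) (a + u), with \<open>p\<close> in the place of
  u.\<close>

lemma disp_down:
  "of_real (sqrt (real (Suc k))) * disp p q m (Suc k) = p * disp p q m k + of_real (sqrt (real m)) * disp p q (m - 1) k"
proof (induction m arbitrary: k)
  case 0
  show ?case by (simp add: real_sqrt_mult del: of_nat_Suc)
next
  case (Suc m)
  let ?s = "\<lambda>i. of_real (sqrt (real i)) :: 'a"
  let ?d = "disp p q"
  \<comment> \<open>Expand \<open>of_nat k * ?d m k\<close> by the induction hypothesis at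
    \<open>k - 1\<close> and \<open>of_nat m * ?d m k\<close> by \<open>disp_up\<close>; both
    contain the same multiple of \<open>?d (m - 1) (k - 1)\<close>, which cancels.\<close>
  have key: "of_nat k * ?d m k + q * (?s m * ?d (m - 1) k) = p * (?s k * ?d m (k - 1)) + of_nat m * ?d m k"
  proof -
    have up: "?s m * (?s m * ?d m k) = ?s m * (?s k * ?d (m - 1) (k - 1) + q * ?d (m - 1) k)"
      by (cases m) (simp, simp only: disp_up diff_Suc_1)
    show ?thesis
    proof (cases k)
      case 0
      then show ?thesis using up by (simp add: mult_ac)
    next
      case (Suc k')
      have "?s k * (?s k * ?d m k) = ?s k * (p * ?d m k' + ?s m * ?d (m - 1) k')"
        unfolding Suc by (simp only: Suc.IH)
      then have "of_nat k * ?d m k = p * (?s k * ?d m (k - 1)) + ?s m * (?s k * ?d (m - 1) (k - 1))"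
        unfolding of_real_sqrt_mult_self_left by (simp add: Suc algebra_simps del: of_nat_Suc)
      then show ?thesis using up by (simp add: algebra_simps)
    qed
  qed
  have "?s (Suc m) * (?s (Suc k) * ?d (Suc m) (Suc k)) = ?s (Suc k) * (?s (Suc m) * ?d (Suc m) (Suc k))"
    by (simp only: mult_ac)
  also have "\<dots> = ?s (Suc k) * (?s (Suc k) * ?d m k) + q * (?s (Suc k) * ?d m (Suc k))"
    unfolding disp_up diff_Suc_1 by (simp only: algebra_simps)
  also have "\<dots> = of_nat (Suc k) * ?d m k + q * (p * ?d m k + ?s m * ?d (m - 1) k)"
    unfolding Suc.IH of_real_sqrt_mult_self_left ..
  also have "\<dots> = p * (?s k * ?d m (k - 1) + q * ?d m k) + of_nat (Suc m) * ?d m k"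
    using key by (simp add: algebra_simps)
  also have "\<dots> = ?s (Suc m) * (p * ?d (Suc m) k + ?s (Suc m) * ?d m k)"
    by (simp only: distrib_left[of "?s (Suc m)"] mult.left_commute[of "?s (Suc m)" p]
          disp_up of_real_sqrt_mult_self_left)
  finally show ?case by (simp del: of_nat_Suc)
qed

lemma disp_right_0: "disp p q m 0 = q ^ m / of_real (sqrt (fact m))"
  by (induction m) (simp_all add: disp.simps(2) real_sqrt_mult)

text \<open>Transposition exchanges the two ladder relations, hence the two parameters.\<close>

lemma disp_swap: "disp p q m k = disp q p k m"
proof (induction m arbitrary: k)
  case 0
  show ?case by (simp add: disp_right_0)
next
  case (Suc m)
  have "of_real (sqrt (real (Suc m))) * disp p q (Suc m) k = of_real (sqrt (real (Suc m))) * disp q p k (Suc m)"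
    unfolding disp_up disp_down Suc by simp
  then show ?case by (simp del: of_nat_Suc)
qed

lemma cnj_disp: "cnj (disp p q m k) = disp (cnj p) (cnj q) m k"
  by (induction m arbitrary: k) (simp_all add: disp.simps(2))

lemma disp_0_0: "disp 0 0 m k = (if m = k then 1 else 0)"
proof (induction m arbitrary: k)
  case 0
  show ?case by (cases k) auto
next
  case (Suc m)
  then show ?case by (cases k) (auto simp: disp.simps(2))
qed

text \<open>Up to a scalar this is coordinate \<open>k\<close> of W(u) applied to the exponential
  vector of \<open>v\<close>. In the induction on \<open>k\<close>, \<open>disp_down\<close>
  multiplies the sum by \<open>p + v\<close>.\<close>

lemma disp_generating_function:
  fixes p q v :: "'a::{real_normed_field,banach}"
  shows "(\<lambda>m. disp p q m k * (v ^ m / of_real (sqrt (fact m)))) sums (exp (q * v) * ((p + v) ^ k / of_real (sqrt (fact k))))"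
proof (induction k)
  case 0
  have "of_real (sqrt (fact m)) * of_real (sqrt (fact m)) = (fact m :: 'a)" for m
    by (simp flip: of_real_mult)
  then have "disp p q m 0 * (v ^ m / of_real (sqrt (fact m))) = (q * v) ^ m /\<^sub>R fact m" for m
    by (simp add: disp_right_0 power_mult_distrib scaleR_conv_of_real divide_inverse mult_ac flip: nonzero_inverse_mult_distrib)
  then show ?case using exp_converges[of "q * v"] by simp
next
  case (Suc k)
  let ?s = "\<lambda>i. of_real (sqrt (real i)) :: 'a"
  let ?e = "\<lambda>m. v ^ m / of_real (sqrt (fact m)) :: 'a"
  let ?S = "exp (q * v) * ((p + v) ^ k / of_real (sqrt (fact k)))"
  have "(\<lambda>m. ?s (Suc m) * disp p q m k * ?e (Suc m)) sums (v * ?S)"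
  proof -
    have "?s (Suc m) * disp p q m k * ?e (Suc m) = v * (disp p q m k * ?e m)" for m
      by (simp add: real_sqrt_mult field_simps del: of_nat_Suc)
    then show ?thesis using sums_mult[OF Suc, of v] by (simp only:)
  qed
  \<comment> \<open>The shift adds only the term at index 0, which vanishes because of
    \<open>?s 0\<close>.\<close>
  then have "(\<lambda>m. ?s m * disp p q (m - 1) k * ?e m) sums (v * ?S)"
    using sums_Suc_iff[of "\<lambda>m. ?s m * disp p q (m - 1) k * ?e m" "v * ?S"]
    by (simp del: of_nat_Suc fact_Suc power_Suc)
  from sums_add[OF sums_mult[OF Suc, of p] this]
  have "(\<lambda>m. (p * disp p q m k + ?s m * disp p q (m - 1) k) * ?e m) sums ((p + v) * ?S)"
    by (simp only: distrib_left distrib_right mult.assoc)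
  then have "(\<lambda>m. ?s (Suc k) * (disp p q m (Suc k) * ?e m)) sums ((p + v) * ?S)"
    unfolding disp_down[symmetric] by (simp only: mult.assoc)
  from sums_divide[OF this, of "?s (Suc k)"] show ?case
    by (simp add: real_sqrt_mult mult_ac del: of_nat_Suc)
qed

section \<open>Size estimates for the coefficients\<close>

lemma disp_nonneg: "0 \<le> t \<Longrightarrow> 0 \<le> (disp t t m k :: real)"
  by (induction m arbitrary: k) (simp_all add: disp.simps(2))

text \<open>The recursion has nonnegative coefficients apart from \<open>p\<close> and
  \<open>q\<close>, so replacing both by a common bound yields a majorant.\<close>

lemma norm_disp_le:
  assumes "norm p \<le> t" "norm q \<le> t"
  shows "norm (disp p q m k) \<le> disp t t m k"
proof (induction m arbitrary: k)
  case 0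
  show ?case using assms by (auto simp: norm_divide norm_power intro!: divide_right_mono power_mono)
next
  case (Suc m)
  have "norm (of_real (sqrt (real k)) * disp p q m (k - 1) + q * disp p q m k)
      \<le> sqrt (real k) * norm (disp p q m (k - 1)) + norm q * norm (disp p q m k)"
    by (rule order_trans[OF norm_triangle_ineq]) (simp add: norm_mult)
  also have "\<dots> \<le> sqrt (real k) * disp t t m (k - 1) + t * disp t t m k"
    using assms order_trans[OF norm_ge_zero assms(2)] by (intro add_mono mult_mono Suc) auto
  finally show ?case by (simp add: disp.simps(2) norm_divide divide_right_mono del: of_nat_Suc)
qed

text \<open>Cauchy estimate: one term of the nonnegative generating series of the majorant is at
  most its sum. The radius \<open>v\<close> stays free for later optimisation.\<close>

lemma norm_disp_bound:
  assumes "norm p \<le> t" "norm q \<le> t" "0 < v"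
  shows "norm (disp p q m k) \<le> sqrt (fact m) / v ^ m * exp (t * v) * ((t + v) ^ k / sqrt (fact k))"
proof -
  have t: "0 \<le> t" using assms(1) norm_ge_zero[of p] by linarith
  have s: "(\<lambda>m. disp t t m k * (v ^ m / sqrt (fact m))) sums (exp (t * v) * ((t + v) ^ k / sqrt (fact k)))"
    using disp_generating_function[of t t k v] by simp
  have "(\<Sum>m\<in>{m}. disp t t m k * (v ^ m / sqrt (fact m))) \<le> exp (t * v) * ((t + v) ^ k / sqrt (fact k))"
    unfolding sums_unique[OF s]
    by (rule sum_le_suminf[OF sums_summable[OF s]]) (use t assms(3) in \<open>auto simp: disp_nonneg\<close>)
  then have "disp t t m k \<le> sqrt (fact m) / v ^ m * (exp (t * v) * ((t + v) ^ k / sqrt (fact k)))"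
    using assms(3) by (simp add: field_simps)
  with norm_disp_le[OF assms(1,2), of m k] show ?thesis by (simp add: mult_ac)
qed

section \<open>The Weyl operator in the number basis\<close>

text \<open>The composition law of displacements in coordinates. The pairing is bilinear;
  conjugation enters only through the parameters. In the step, \<open>disp_up\<close> takes a
  creation operator off the left factor, a shift of \<open>k\<close> moves it across, and
  \<open>disp_down\<close> absorbs it on the right.\<close>

lemma disp_pairing:
  fixes p q p' q' :: "'a::{real_normed_field,banach}"
  shows "(\<lambda>k. disp p q m k * disp p' q' l k) sums (exp (p * p') * disp (p + q') (p' + q) m l)"
proof (induction m arbitrary: l)
  case 0
  show ?case
    using disp_generating_function[of q' p' l p]
    by (simp add: disp_swap[of p' q' l] mult_ac add.commute)
next
  case (Suc m)
  let ?s = "\<lambda>i. of_real (sqrt (real i)) :: 'a"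
  let ?f = "disp p q" and ?g = "disp p' q'" and ?B = "\<lambda>m l. exp (p * p') * disp (p + q') (p' + q) m l"
  have "(\<lambda>k. p' * (?f m k * ?g l k) + ?s l * (?f m k * ?g (l - 1) k)) sums (p' * ?B m l + ?s l * ?B m (l - 1))"
    by (intro sums_add sums_mult Suc)
  also have "(\<lambda>k. p' * (?f m k * ?g l k) + ?s l * (?f m k * ?g (l - 1) k)) =
             (\<lambda>k. ?f m k * (?s (Suc k) * ?g l (Suc k)))"
    unfolding disp_down by (simp add: algebra_simps)
  finally have "(\<lambda>k. ?s k * ?f m (k - 1) * ?g l k) sums (p' * ?B m l + ?s l * ?B m (l - 1))"
    using sums_Suc_iff[of "\<lambda>k. ?s k * ?f m (k - 1) * ?g l k" "p' * ?B m l + ?s l * ?B m (l - 1)"]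
    by (simp add: mult_ac del: of_nat_Suc)
  from sums_add[OF this sums_mult[OF Suc, of q l]]
  have "(\<lambda>k. (?s k * ?f m (k - 1) + q * ?f m k) * ?g l k) sums (exp (p * p') * (?s l * disp (p + q') (p' + q) m (l - 1) + (p' + q) * disp (p + q') (p' + q) m l))"
    by (simp add: algebra_simps)
  then have "(\<lambda>k. ?s (Suc m) * (?f (Suc m) k * ?g l k)) sums (?s (Suc m) * ?B (Suc m) l)"
    unfolding disp_up[symmetric] by (simp only: mult_ac)
  from sums_divide[OF this, of "?s (Suc m)"] show ?case
    by (simp del: of_nat_Suc)
qed

lemma l2_disp: "l2 (disp p q m)"
  by (rule l2_if_sums) (simp only: cnj_disp, rule disp_pairing)

section \<open>Exponential vectors and uniqueness of unitaries\<close>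

lemma expvec_eq_disp: "expvec v = disp v 0 0"
  by (simp add: expvec_def)

lemma l2_expvec [simp]: "l2 (expvec v)"
  by (simp only: expvec_eq_disp l2_disp)

lemma l2_inner_expvec:
  assumes "l2 f"
  shows "(\<lambda>k. f k / complex_of_real (sqrt (fact k)) * cnj v ^ k) sums l2_inner (expvec v) f"
proof -
  have "summable (\<lambda>k. cnj (expvec v k) * f k)"
    by (intro summable_norm_cancel[OF l2_mult_summable]) (simp_all add: assms)
  from summable_sums[OF this] show ?thesis
    unfolding l2_inner_def by (simp add: expvec_def mult_ac)
qed

text \<open>The pairings are values of a power series in \<open>cnj v\<close> with coefficients
  \<open>f k / sqrt (fact k)\<close>, and power series agreeing near 0 have equal
  coefficients.\<close>

lemma expvec_separating:
  assumes f: "l2 f" and h: "l2 h"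
    and eq: "\<And>v. l2_inner (expvec v) f = l2_inner (expvec v) h"
  shows "f = h"
proof -
  let ?F = "\<lambda>f. Abs_fps (\<lambda>k. f k / complex_of_real (sqrt (fact k)))"
  have sums: "(\<lambda>k. fps_nth (?F g) k * z ^ k) sums l2_inner (expvec (cnj z)) g" if "l2 g" for g z
    using l2_inner_expvec[OF that, of "cnj z"] by simp
  have radius: "fps_conv_radius (?F g) > 0" if "l2 g" for g
  proof -
    have "fps_conv_radius (?F g) \<ge> norm (1 :: complex)"
      unfolding fps_conv_radius_def by (rule conv_radius_geI) (rule sums_summable[OF sums[OF that]])
    then show ?thesis by (rule less_le_trans[rotated]) simp
  qed
  have "?F f = ?F h"
  proof (rule eval_fps_eqD)
    show "\<forall>\<^sub>F z in nhds 0. eval_fps (?F f) z = eval_fps (?F h) z"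
      unfolding eval_fps_def sums_unique[OF sums[OF f], symmetric] sums_unique[OF sums[OF h], symmetric]
      by (simp add: eq)
  qed (rule radius[OF f] radius[OF h])+
  then have "fps_nth (?F f) k = fps_nth (?F h) k" for k by (simp only:)
  then show ?thesis by (auto simp: fun_eq_iff)
qed

lemma is_unitary_l2: "is_unitary U \<Longrightarrow> l2 f \<Longrightarrow> l2 (U f)"
  unfolding is_unitary_def by blast

lemma is_unitary_surj: "is_unitary U \<Longrightarrow> l2 g \<Longrightarrow> \<exists>f. l2 f \<and> U f = g"
  unfolding is_unitary_def by blast

lemma is_unitary_inner: "is_unitary U \<Longrightarrow> l2 f \<Longrightarrow> l2 g \<Longrightarrow> l2_inner (U f) (U g) = l2_inner f g"
  unfolding is_unitary_def by blast

lemma is_unitary_not_l2: "is_unitary U \<Longrightarrow> \<not> l2 f \<Longrightarrow> U f = (\<lambda>_. 0)"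
  unfolding is_unitary_def by blast

text \<open>Surjectivity of \<open>V\<close> replaces a density argument: if
  \<open>U f = V h\<close>, isometry gives \<open>f\<close> and \<open>h\<close> the same pairings
  with exponential vectors.\<close>

lemma is_unitary_eq_if_eq_expvec:
  assumes U: "is_unitary U" and V: "is_unitary V" and eq: "\<And>v. U (expvec v) = V (expvec v)"
  shows "U = V"
proof
  fix f
  show "U f = V f"
  proof (cases "l2 f")
    case True
    then have "l2 (U f)" by (rule is_unitary_l2[OF U])
    then obtain h where h: "l2 h" "V h = U f" using is_unitary_surj[OF V] by blast
    have "f = h"
    proof (rule expvec_separating)
      fix v
      have "l2_inner (expvec v) f = l2_inner (U (expvec v)) (U f)"
        by (rule is_unitary_inner[OF U l2_expvec True, symmetric])
      also have "\<dots> = l2_inner (V (expvec v)) (V h)" by (simp add: eq h)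
      also have "\<dots> = l2_inner (expvec v) h" by (rule is_unitary_inner[OF V l2_expvec h(1)])
      finally show "l2_inner (expvec v) f = l2_inner (expvec v) h" .
    qed (rule True h(1))+
    with h(2) show ?thesis by simp
  next
    case False
    then show ?thesis using is_unitary_not_l2[OF U] is_unitary_not_l2[OF V] by simp
  qed
qed

section \<open>The matrix of the Weyl operator\<close>

text \<open>The row index comes first here, whereas \<open>disp\<close> takes the column index
  first.\<close>

definition weyl_matrix :: "complex \<Rightarrow> nat \<Rightarrow> nat \<Rightarrow> complex" where
  "weyl_matrix u k m = complex_of_real (exp (- ((cmod u)\<^sup>2 / 2))) * disp u (- cnj u) m k"

text \<open>Stated for two displacements: \<open>u = v\<close> gives orthonormal columns, and the
  general case gives the overlaps in the entropy.\<close>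

lemma weyl_matrix_pairing:
  "(\<lambda>k. cnj (weyl_matrix u k m) * weyl_matrix v k l) sums
     (complex_of_real (exp (- ((cmod u)\<^sup>2 / 2)) * exp (- ((cmod v)\<^sup>2 / 2))) * exp (cnj u * v) * disp (- cnj (v - u)) (v - u) m l)"
  using sums_mult[OF disp_pairing[of "cnj u" "- u" m v "- cnj v" l],
      of "complex_of_real (exp (- ((cmod u)\<^sup>2 / 2)) * exp (- ((cmod v)\<^sup>2 / 2)))"]
  by (simp add: weyl_matrix_def cnj_disp mult_ac)

lemma isometric_weyl_matrix: "isometric_matrix (weyl_matrix u)"
  unfolding isometric_matrix_def
proof (intro conjI allI)
  fix k m l
  have "weyl_matrix u k = (\<lambda>m. complex_of_real (exp (- ((cmod u)\<^sup>2 / 2))) * disp (- cnj u) u k m)"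
    by (rule ext) (simp add: weyl_matrix_def disp_swap[of u])
  then show "l2 (weyl_matrix u k)" by (simp add: l2_cmult l2_disp del: of_real_exp)
  have "complex_of_real (exp (- ((cmod u)\<^sup>2 / 2)) * exp (- ((cmod u)\<^sup>2 / 2))) * exp (cnj u * u) = 1"
  proof -
    have "cnj u * u = complex_of_real ((cmod u)\<^sup>2)" by (simp only: complex_norm_square mult.commute)
    then show ?thesis by (simp only: exp_of_real of_real_mult[symmetric] exp_add[symmetric]) simp
  qed
  then show "(\<lambda>k. cnj (weyl_matrix u k m) * weyl_matrix u k l) sums (if m = l then 1 else 0)"
    using weyl_matrix_pairing[of u m u l] by (simp only: diff_self complex_cnj_zero minus_zero disp_0_0) (simp split: if_splits)
qed

text \<open>The adjoint of W(u) is W(-u), so the rows are orthonormal as well.\<close>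

lemma cnj_weyl_matrix: "(\<lambda>m k. cnj (weyl_matrix u k m)) = weyl_matrix (- u)"
  by (intro ext) (simp add: weyl_matrix_def cnj_disp disp_swap[of "- u"])

lemma weyl_eq_matop: "weyl u = (\<lambda>f. if l2 f then matop (weyl_matrix u) f else (\<lambda>_. 0))"
  unfolding weyl_def
proof (rule the_equality)
  let ?U = "\<lambda>f. if l2 f then matop (weyl_matrix u) f else (\<lambda>_. 0)"
  have act: "?U (expvec v) = (\<lambda>k. exp (- complex_of_real ((cmod u)\<^sup>2 / 2) - cnj u * v) * expvec (u + v) k)" for v
  proof
    fix k
    from sums_mult[OF disp_generating_function[of u "- cnj u" k v], of "complex_of_real (exp (- ((cmod u)\<^sup>2 / 2)))"]
    have "(\<lambda>m. weyl_matrix u k m * expvec v m) sums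
        (complex_of_real (exp (- ((cmod u)\<^sup>2 / 2))) * (exp (- cnj u * v) * ((u + v) ^ k / of_real (sqrt (fact k)))))"
      by (simp only: weyl_matrix_def expvec_def mult.assoc)
    also have "complex_of_real (exp (- ((cmod u)\<^sup>2 / 2))) * (exp (- cnj u * v) * ((u + v) ^ k / of_real (sqrt (fact k)))) =
        exp (- complex_of_real ((cmod u)\<^sup>2 / 2) - cnj u * v) * expvec (u + v) k"
      unfolding exp_of_real[symmetric] of_real_minus expvec_def mult.assoc[symmetric] mult_exp_exp by simp
    finally show "?U (expvec v) k = exp (- complex_of_real ((cmod u)\<^sup>2 / 2) - cnj u * v) * expvec (u + v) k"
      using sums_unique[of "\<lambda>m. weyl_matrix u k m * expvec v m"] by (simp only: l2_expvec if_True matop_def)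
  qed
  have un: "is_unitary ?U"
    by (rule is_unitary_matop[OF isometric_weyl_matrix]) (simp only: cnj_weyl_matrix isometric_weyl_matrix)
  show "is_unitary ?U \<and> (\<forall>v. ?U (expvec v) = (\<lambda>k. exp (- complex_of_real ((cmod u)\<^sup>2 / 2) - cnj u * v) * expvec (u + v) k))"
    by (intro conjI un allI act)
  fix V
  assume V: "is_unitary V \<and> (\<forall>v. V (expvec v) = (\<lambda>k. exp (- complex_of_real ((cmod u)\<^sup>2 / 2) - cnj u * v) * expvec (u + v) k))"
  show "V = ?U"
  proof (rule is_unitary_eq_if_eq_expvec[OF _ un])
    show "V (expvec v) = ?U (expvec v)" for v
      unfolding act using V by blast
  qed (use V in blast)
qed

lemma weyl_ket_eq: "weyl u (ket m) = (\<lambda>k. weyl_matrix u k m)"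
proof
  fix k
  have "(\<lambda>l. weyl_matrix u k l * ket m l) sums weyl_matrix u k m"
    using sums_single[of m "weyl_matrix u k"] by (simp add: ket_def if_distrib cong: if_cong)
  then show "weyl u (ket m) k = weyl_matrix u k m"
    by (simp add: weyl_eq_matop matop_def sums_iff)
qed

section \<open>Number statistics of displaced number states\<close>

text \<open>The mass is not 1 because \<open>disp\<close> omits the Gaussian prefactor.\<close>

lemma disp_norm_sums:
  "(\<lambda>k. (cmod (disp w (- cnj w) m k))\<^sup>2) sums exp ((cmod w)\<^sup>2)"
proof -
  have "(\<lambda>k. complex_of_real ((cmod (disp w (- cnj w) m k))\<^sup>2)) sums complex_of_real (exp ((cmod w)\<^sup>2))"
    using disp_pairing[of "cnj w" "- w" m w "- cnj w" m]
    by (simp add: disp_0_0 complex_norm_square cnj_disp mult.commute flip: exp_of_real del: of_real_power)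
  then show ?thesis by (simp only: sums_of_real_iff)
qed

text \<open>The squared norm of a W(w)|m>: by \<open>disp_down\<close> this vector combines the
  displaced states of index \<open>m\<close> and \<open>m - 1\<close>, which are orthogonal for
  positive \<open>m\<close>.\<close>

lemma disp_number_sums:
  "(\<lambda>k. real k * (cmod (disp w (- cnj w) m k))\<^sup>2) sums (exp ((cmod w)\<^sup>2) * ((cmod w)\<^sup>2 + real m))"
proof -
  let ?F = "disp (cnj w) (- w)" and ?G = "disp w (- cnj w)"
  let ?s = "\<lambda>i. complex_of_real (sqrt (real i))"
  have pair: "(\<lambda>k. ?F i k * ?G l k) sums (exp (cnj w * w) * (if i = l then 1 else 0))" for i l
    using disp_pairing[of "cnj w" "- w" i w "- cnj w" l] by (simp add: disp_0_0)
  have "(\<lambda>k. cnj w * w * (?F m k * ?G m k) + cnj w * ?s m * (?F m k * ?G (m - 1) k) +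
          (?s m * w * (?F (m - 1) k * ?G m k) + ?s m * ?s m * (?F (m - 1) k * ?G (m - 1) k)))
     sums (cnj w * w * (exp (cnj w * w) * (if m = m then 1 else 0)) + cnj w * ?s m * (exp (cnj w * w) * (if m = m - 1 then 1 else 0)) +
          (?s m * w * (exp (cnj w * w) * (if m - 1 = m then 1 else 0)) + ?s m * ?s m * (exp (cnj w * w) * (if m - 1 = m - 1 then 1 else 0))))"
    by (intro sums_add sums_mult pair)
  also have "(\<lambda>k. cnj w * w * (?F m k * ?G m k) + cnj w * ?s m * (?F m k * ?G (m - 1) k) +
          (?s m * w * (?F (m - 1) k * ?G m k) + ?s m * ?s m * (?F (m - 1) k * ?G (m - 1) k))) =
        (\<lambda>k. (cnj w * ?F m k + ?s m * ?F (m - 1) k) * (w * ?G m k + ?s m * ?G (m - 1) k))"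
    by (simp only: algebra_simps)
  also have "\<dots> = (\<lambda>k. complex_of_real (real (Suc k) * (cmod (?G m (Suc k)))\<^sup>2))"
    unfolding disp_down[symmetric]
    by (rule ext) (simp add: complex_norm_square cnj_disp mult_ac del: of_real_power of_nat_Suc)
  also have "cnj w * w * (exp (cnj w * w) * (if m = m then 1 else 0)) + cnj w * ?s m * (exp (cnj w * w) * (if m = m - 1 then 1 else 0)) +
          (?s m * w * (exp (cnj w * w) * (if m - 1 = m then 1 else 0)) + ?s m * ?s m * (exp (cnj w * w) * (if m - 1 = m - 1 then 1 else 0)))
       = complex_of_real (exp ((cmod w)\<^sup>2) * ((cmod w)\<^sup>2 + real m))"
    \<comment> \<open>For \<open>m = 0\<close> the indices \<open>m\<close> and \<open>m - 1\<close>
      coincide, but the cross terms carry the factor \<open>?s 0\<close>.\<close>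
    by (cases "m = 0") (simp_all add: complex_norm_square algebra_simps flip: exp_of_real del: of_real_power)
  finally have "(\<lambda>k. real (Suc k) * (cmod (?G m (Suc k)))\<^sup>2) sums (exp ((cmod w)\<^sup>2) * ((cmod w)\<^sup>2 + real m))"
    by (simp only: sums_of_real_iff)
  then show ?thesis
    using sums_Suc_iff[of "\<lambda>k. real k * (cmod (?G m k))\<^sup>2"] by simp
qed

text \<open>Jensen for an unnormalised weight of mass \<open>S\<close> and mean
  \<open>\<mu>\<close>: the tangent of the exponential at the mean is averaged, and its linear part
  cancels.\<close>

lemma Jensen_exp_sums:
  fixes p :: "nat \<Rightarrow> real"
  assumes nonneg: "\<And>k. 0 \<le> p k" and S: "p sums S" and M: "(\<lambda>k. real k * p k) sums (S * \<mu>)" and a: "0 \<le> a"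
  shows "summable (\<lambda>k. exp (- a * real k) * p k)"
    and "S * exp (- a * \<mu>) \<le> (\<Sum>k. exp (- a * real k) * p k)"
proof -
  show sm: "summable (\<lambda>k. exp (- a * real k) * p k)"
    by (rule summable_comparison_test'[OF sums_summable[OF S]]) (use a nonneg in \<open>auto simp: mult_left_le_one_le\<close>)
  have "(\<lambda>k. exp (- a * \<mu>) * ((1 + a * \<mu>) * p k - a * (real k * p k))) sums
      (exp (- a * \<mu>) * ((1 + a * \<mu>) * S - a * (S * \<mu>)))"
    by (intro sums_mult sums_diff S M)
  also have "exp (- a * \<mu>) * ((1 + a * \<mu>) * S - a * (S * \<mu>)) = S * exp (- a * \<mu>)"
    by (simp add: algebra_simps)
  finally have t: "(\<lambda>k. exp (- a * \<mu>) * ((1 + a * \<mu>) * p k - a * (real k * p k))) sums (S * exp (- a * \<mu>))" .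
  show "S * exp (- a * \<mu>) \<le> (\<Sum>k. exp (- a * real k) * p k)"
  proof (rule sums_le[OF _ t summable_sums[OF sm]])
    fix k
    have "1 + a * (\<mu> - real k) \<le> exp (a * (\<mu> - real k))" by (rule exp_ge_add_one_self)
    then have "exp (- a * \<mu>) * (1 + a * (\<mu> - real k)) * p k \<le> exp (- a * \<mu>) * exp (a * (\<mu> - real k)) * p k"
      using nonneg[of k] by (intro mult_right_mono mult_left_mono) auto
    then show "exp (- a * \<mu>) * ((1 + a * \<mu>) * p k - a * (real k * p k)) \<le> exp (- a * real k) * p k"
      by (simp add: algebra_simps flip: exp_add)
  qed
qed

text \<open>A weak Stirling bound; the step rests on (1 - 1/(m+1))^(m+1) \<le> 1/e.\<close>

lemma fact_times_exp_le:
  assumes "0 < m"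
  shows "fact m * exp (real m) \<le> exp 1 * real m * real m ^ m"
  using assms
proof (induction m rule: nat_induct_non_zero)
  case 1
  show ?case by simp
next
  case (Suc m)
  have e: "exp 1 * real m ^ Suc m \<le> real (Suc m) ^ Suc m"
  proof -
    have "real m / real (Suc m) = 1 + - (1 / real (Suc m))" by (simp add: field_simps)
    also have "\<dots> \<le> exp (- (1 / real (Suc m)))" by (rule exp_ge_add_one_self)
    finally have "(real m / real (Suc m)) ^ Suc m \<le> exp (- (1 / real (Suc m))) ^ Suc m"
      by (intro power_mono) auto
    also have "\<dots> = exp (- 1)" by (subst exp_of_nat_mult[symmetric]) (simp del: of_nat_Suc)
    finally have "real m ^ Suc m \<le> exp (- 1) * real (Suc m) ^ Suc m"
      unfolding power_divide by (subst (asm) pos_divide_le_eq) simp_all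
    then have "exp 1 * real m ^ Suc m \<le> exp 1 * (exp (- 1) * real (Suc m) ^ Suc m)"
      by (intro mult_left_mono) auto
    also have "\<dots> = real (Suc m) ^ Suc m"
      by (simp only: mult.assoc[symmetric] exp_add[symmetric]) simp
    finally show ?thesis .
  qed
  have "fact (Suc m) * exp (real (Suc m)) = real (Suc m) * exp 1 * (fact m * exp (real m))"
    by (simp add: exp_add algebra_simps)
  also have "\<dots> \<le> real (Suc m) * exp 1 * (exp 1 * real m * real m ^ m)"
    by (intro mult_left_mono Suc) auto
  also have "\<dots> = exp 1 * real (Suc m) * (exp 1 * real m ^ Suc m)" by (simp add: mult_ac)
  also have "\<dots> \<le> exp 1 * real (Suc m) * real (Suc m) ^ Suc m"
    by (intro mult_left_mono e) auto
  finally show ?case .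
qed

text \<open>Squaring the Cauchy estimate leaves \<open>fact k\<close> in the denominator, so the
  bounds sum to an exponential series.\<close>

lemma disp_weighted_sum_le:
  assumes v: "0 < v"
  shows "(\<Sum>k. exp (- a * real k) * (cmod (disp w (- cnj w) m k))\<^sup>2)
     \<le> fact m / v ^ (2 * m) * exp (2 * cmod w * v + exp (- a) * (cmod w + v)\<^sup>2)" (is "?lhs \<le> ?rhs")
    and "summable (\<lambda>k. exp (- a * real k) * (cmod (disp w (- cnj w) m k))\<^sup>2)"
proof -
  let ?t = "cmod w" and ?C = "fact m / v ^ (2 * m) * exp (2 * cmod w * v)"
  have pt: "exp (- a * real k) * (cmod (disp w (- cnj w) m k))\<^sup>2 \<le> ?C * ((exp (- a) * (?t + v)\<^sup>2) ^ k /\<^sub>R fact k)" for k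
  proof -
    have "(cmod (disp w (- cnj w) m k))\<^sup>2 \<le> (sqrt (fact m) / v ^ m * exp (?t * v) * ((?t + v) ^ k / sqrt (fact k)))\<^sup>2"
      by (intro power_mono norm_disp_bound) (auto simp: v)
    also have "\<dots> = ?C * ((?t + v)\<^sup>2) ^ k / fact k"
    proof -
      have "(sqrt (fact m) / v ^ m)\<^sup>2 = fact m / v ^ (2 * m)" by (simp add: power_divide power_even_eq)
      moreover have "(exp (?t * v))\<^sup>2 = exp (2 * ?t * v)" by (simp only: exp_double[symmetric] mult.assoc)
      moreover have "((?t + v) ^ k / sqrt (fact k))\<^sup>2 = ((?t + v)\<^sup>2) ^ k / fact k"
        by (simp add: power_divide power_commutes flip: power_mult) (simp add: mult.commute)
      ultimately show ?thesis by (simp only: power_mult_distrib) simp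
    qed
    finally have "exp (- a) ^ k * (cmod (disp w (- cnj w) m k))\<^sup>2 \<le> exp (- a) ^ k * (?C * ((?t + v)\<^sup>2) ^ k / fact k)"
      by (intro mult_left_mono) auto
    then show ?thesis
      by (simp add: power_mult_distrib divide_inverse mult_ac flip: exp_of_nat_mult)
  qed
  have s: "(\<lambda>k. ?C * ((exp (- a) * (?t + v)\<^sup>2) ^ k /\<^sub>R fact k)) sums (?C * exp (exp (- a) * (?t + v)\<^sup>2))"
    by (intro sums_mult exp_converges)
  show sm: "summable (\<lambda>k. exp (- a * real k) * (cmod (disp w (- cnj w) m k))\<^sup>2)"
    by (rule summable_comparison_test'[OF sums_summable[OF s], of 0]) (use pt in auto)
  have "?lhs \<le> ?C * exp (exp (- a) * (?t + v)\<^sup>2)"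
    by (rule sums_le[OF pt summable_sums[OF sm] s])
  then show "?lhs \<le> ?rhs" by (simp add: exp_add mult_ac)
qed

section \<open>Summability over one and several modes\<close>

lemma has_sum_suminf_nonneg:
  fixes f :: "nat \<Rightarrow> real"
  assumes "summable f" "\<And>k. 0 \<le> f k"
  shows "(f has_sum suminf f) UNIV"
  by (rule sums_nonneg_imp_has_sum[OF summable_sums]) (use assms in auto)

text \<open>In the pair, \<open>k\<close> labels the eigenvector of the first state and
  \<open>m\<close> that of the second; the constant prefactor is kept apart in
  \<open>mode_const\<close>.\<close>

definition mode_weight :: "real \<Rightarrow> real \<Rightarrow> complex \<Rightarrow> nat \<times> nat \<Rightarrow> real" where
  "mode_weight a b w = (\<lambda>(k, m). exp (- a * real k) * exp (b * real m) * (cmod (disp w (- cnj w) m k))\<^sup>2)"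

lemma mode_weight_nonneg: "0 \<le> mode_weight a b w x"
  by (simp add: mode_weight_def split: prod.split)

lemma mode_weight_not_summable:
  assumes "0 \<le> a" "a \<le> b"
  shows "\<not> mode_weight a b w summable_on UNIV"
proof
  define c where "c m = (\<Sum>k. exp (- a * real k) * (cmod (disp w (- cnj w) m k))\<^sup>2)" for m
  \<comment> \<open>Jensen's lower bound at \<open>m = 0\<close>; for \<open>a \<le> b\<close> the
    factor \<open>exp ((b - a) * real m)\<close> is at least 1, so it bounds every weighted
    column.\<close>
  define \<epsilon> where "\<epsilon> = exp ((cmod w)\<^sup>2) * exp (- a * (cmod w)\<^sup>2)"
  have sm: "summable (\<lambda>k. exp (- a * real k) * (cmod (disp w (- cnj w) m k))\<^sup>2)"
    and c: "exp ((cmod w)\<^sup>2) * exp (- a * ((cmod w)\<^sup>2 + real m)) \<le> c m" for m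
    using Jensen_exp_sums[OF _ disp_norm_sums disp_number_sums assms(1), of w m] by (auto simp: c_def)
  assume "mode_weight a b w summable_on UNIV"
  then have "(\<lambda>(m, k). mode_weight a b w (k, m)) summable_on UNIV \<times> UNIV"
    using summable_on_swap[of "mode_weight a b w" UNIV UNIV] by simp
  then have "(\<lambda>m. \<Sum>\<^sub>\<infinity>k. mode_weight a b w (k, m)) summable_on UNIV"
    by (rule summable_on_Sigma_banach)
  moreover have "(\<Sum>\<^sub>\<infinity>k. mode_weight a b w (k, m)) = exp (b * real m) * c m" for m
    using infsumI[OF has_sum_cmult_right[OF has_sum_suminf_nonneg[OF sm[of m]], of "exp (b * real m)"]]
    by (simp add: mode_weight_def c_def mult_ac)
  ultimately have "(\<lambda>m. exp (b * real m) * c m) summable_on UNIV"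
    by simp
  then have "summable (\<lambda>m. exp (b * real m) * c m)"
    by (rule summable_on_imp_summable)
  moreover have "norm \<epsilon> \<le> exp (b * real m) * c m" for m
  proof -
    have "norm \<epsilon> = exp ((cmod w)\<^sup>2 - a * (cmod w)\<^sup>2)" by (simp add: \<epsilon>_def flip: exp_add)
    also have "\<dots> \<le> exp ((cmod w)\<^sup>2 - a * (cmod w)\<^sup>2 + (b - a) * real m)" using assms by simp
    also have "\<dots> = exp (b * real m) * (exp ((cmod w)\<^sup>2) * exp (- a * ((cmod w)\<^sup>2 + real m)))"
      by (simp add: algebra_simps flip: exp_add)
    also have "\<dots> \<le> exp (b * real m) * c m" by (intro mult_left_mono c) auto
    finally show ?thesis .
  qed
  ultimately have "summable (\<lambda>m::nat. \<epsilon>)"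
    by (rule summable_comparison_test'[where N = 0])
  then have "\<epsilon> = 0" by (simp only: summable_const_iff)
  then show False by (simp add: \<epsilon>_def)
qed

lemma mode_weight_column_le:
  assumes "b < a"
  shows "\<exists>K q. 0 \<le> q \<and> q < 1 \<and>
    (\<forall>m>0. exp (b * real m) * (\<Sum>k. exp (- a * real k) * (cmod (disp w (- cnj w) m k))\<^sup>2) \<le> K * q ^ m)"
proof (intro exI conjI allI impI)
  \<comment> \<open>Of the available decay rate \<open>4 * \<delta>\<close>, one
    \<open>\<delta>\<close> absorbs the term in \<open>sqrt m\<close>, one the factor
    \<open>m\<close> from Stirling, and \<open>2 * \<delta>\<close> remains.\<close>
  define t x \<delta> where "t = cmod w" and "x = exp (- a)" and "\<delta> = (a - b) / 4"
  \<comment> \<open>The coefficient of \<open>sqrt m\<close> in the exponent once \<open>v\<close>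
    is inserted.\<close>
  define c where "c = 2 * t * (1 + x) / sqrt x"
  have pos: "0 \<le> t" "0 < x" "0 < \<delta>" using assms by (auto simp: t_def x_def \<delta>_def)
  show "0 \<le> exp (- 2 * \<delta>)" "exp (- 2 * \<delta>) < 1" using pos by auto
  fix m :: nat
  assume m: "0 < m"
  \<comment> \<open>the choice that balances \<open>fact m / v ^ (2 * m)\<close> against \<open>exp (x * v\<^sup>2)\<close>\<close>
  define v where "v = sqrt (real m) / sqrt x"
  have v: "0 < v" using m pos by (simp add: v_def)
  have v2: "v\<^sup>2 = real m / x" using pos by (simp add: v_def power_divide)
  have cv: "2 * t * v + x * (t + v)\<^sup>2 = x * t\<^sup>2 + c * sqrt (real m) + real m"
  proof -
    have "x * v\<^sup>2 = real m" using pos by (simp add: v2)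
    moreover have "c * sqrt (real m) = 2 * t * (1 + x) * v" by (simp add: c_def v_def)
    ultimately show ?thesis by (simp add: power2_sum algebra_simps)
  qed
  \<comment> \<open>Completing the square trades \<open>sqrt m\<close> for a small linear term plus
    a constant.\<close>
  have sq: "c * sqrt (real m) \<le> \<delta> * real m + c\<^sup>2 / (4 * \<delta>)"
  proof -
    have "0 \<le> (2 * \<delta> * sqrt (real m) - c)\<^sup>2" by simp
    also have "\<dots> = 4 * \<delta> * (\<delta> * real m + c\<^sup>2 / (4 * \<delta>) - c * sqrt (real m))"
      using pos by (simp add: power2_diff power_mult_distrib algebra_simps) (simp add: power2_eq_square)
    finally show ?thesis using pos by (simp add: zero_le_mult_iff)
  qed
  have lin: "real m \<le> exp (\<delta> * real m) / \<delta>"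
  proof -
    have "\<delta> * real m \<le> exp (\<delta> * real m)"
      using exp_ge_add_one_self[of "\<delta> * real m"] by linarith
    then show ?thesis using pos by (simp add: pos_le_divide_eq mult.commute)
  qed
  have vm: "fact m / v ^ (2 * m) = fact m * x ^ m / real m ^ m"
    by (simp add: power_mult v2 power_divide)
  have "(\<Sum>k. exp (- a * real k) * (cmod (disp w (- cnj w) m k))\<^sup>2)
      \<le> fact m / v ^ (2 * m) * exp (2 * t * v + x * (t + v)\<^sup>2)"
    using disp_weighted_sum_le(1)[OF v, of a w m] by (simp add: t_def x_def)
  also have "\<dots> = x ^ m / real m ^ m * (fact m * exp (real m)) * exp (x * t\<^sup>2 + c * sqrt (real m))"
    unfolding vm cv by (simp add: exp_add)
  also have "\<dots> \<le> x ^ m / real m ^ m * (exp 1 * real m * real m ^ m) * exp (x * t\<^sup>2 + c * sqrt (real m))"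
    using pos by (intro mult_right_mono[OF mult_left_mono[OF fact_times_exp_le[OF m]]]) auto
  also have "\<dots> = exp (- a * real m) * exp 1 * real m * exp (x * t\<^sup>2 + c * sqrt (real m))"
    using m by (simp add: x_def exp_of_nat_mult[symmetric] mult.commute[of _ a])
  also have "\<dots> \<le> exp (- a * real m) * exp 1 * (exp (\<delta> * real m) / \<delta>) * exp (x * t\<^sup>2 + (\<delta> * real m + c\<^sup>2 / (4 * \<delta>)))"
    by (rule mult_mono[OF mult_left_mono[OF lin]]) (use pos sq in auto)
  finally have "exp (b * real m) * (\<Sum>k. exp (- a * real k) * (cmod (disp w (- cnj w) m k))\<^sup>2) \<le>
      exp (b * real m) * (exp (- a * real m) * exp 1 * (exp (\<delta> * real m) / \<delta>) * exp (x * t\<^sup>2 + (\<delta> * real m + c\<^sup>2 / (4 * \<delta>))))"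
    by (intro mult_left_mono) auto
  also have "\<dots> = exp (1 + x * t\<^sup>2 + c\<^sup>2 / (4 * \<delta>)) / \<delta> * exp ((b - a + 2 * \<delta>) * real m)"
    by (simp add: algebra_simps flip: exp_add)
  also have "(b - a + 2 * \<delta>) * real m = real m * (- 2 * \<delta>)" by (simp add: \<delta>_def field_simps)
  also have "exp (real m * (- 2 * \<delta>)) = exp (- 2 * \<delta>) ^ m" by (rule exp_of_nat_mult)
  finally show "exp (b * real m) * (\<Sum>k. exp (- a * real k) * (cmod (disp w (- cnj w) m k))\<^sup>2)
     \<le> exp (1 + x * t\<^sup>2 + c\<^sup>2 / (4 * \<delta>)) / \<delta> * exp (- 2 * \<delta>) ^ m" .
qed

lemma mode_weight_summable:
  assumes "b < a"
  shows "mode_weight a b w summable_on UNIV"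
proof -
  let ?c = "\<lambda>m. \<Sum>k. exp (- a * real k) * (cmod (disp w (- cnj w) m k))\<^sup>2"
  have sm: "summable (\<lambda>k. exp (- a * real k) * (cmod (disp w (- cnj w) m k))\<^sup>2)" for m
    \<comment> \<open>For mere convergence any positive radius serves.\<close>
    by (rule disp_weighted_sum_le(2)[of 1]) simp
  have c0: "0 \<le> ?c m" for m
    by (rule suminf_nonneg[OF sm]) simp
  obtain K q where q: "0 \<le> q" "q < 1" and Kq: "\<forall>m>0. exp (b * real m) * ?c m \<le> K * q ^ m"
    using mode_weight_column_le[OF assms, of w] by (elim exE conjE) (rule that)
  have "summable (\<lambda>m. exp (b * real m) * ?c m)"
  proof (rule summable_comparison_test')
    show "summable (\<lambda>m. K * q ^ m)" using q by (intro summable_mult summable_geometric) auto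
    \<comment> \<open>The geometric bound covers positive \<open>m\<close> only, so the comparison
      starts at 1.\<close>
    show "norm (exp (b * real m) * ?c m) \<le> K * q ^ m" if "1 \<le> m" for m
      using Kq[rule_format, of m] c0[of m] that by (simp add: abs_mult)
  qed
  then have "(\<lambda>m. exp (b * real m) * ?c m) summable_on UNIV"
    by (rule summable_nonneg_imp_summable_on) (intro mult_nonneg_nonneg exp_ge_zero c0)
  moreover have "((\<lambda>k. mode_weight a b w (k, m)) has_sum exp (b * real m) * ?c m) UNIV" for m
  proof -
    have "((\<lambda>k. exp (- a * real k) * (cmod (disp w (- cnj w) m k))\<^sup>2) has_sum ?c m) UNIV"
      by (rule has_sum_suminf_nonneg[OF sm]) simp
    from has_sum_cmult_right[OF this, of "exp (b * real m)"] show ?thesis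
      by (simp add: mode_weight_def mult.assoc mult.left_commute)
  qed
  ultimately have "(\<lambda>(m, k). mode_weight a b w (k, m)) summable_on UNIV \<times> UNIV"
    by (intro summable_on_SigmaI[where g = "\<lambda>m. exp (b * real m) * ?c m"]) (simp_all add: mode_weight_nonneg)
  then show ?thesis
    using summable_on_swap[of "mode_weight a b w" UNIV UNIV] by simp
qed

lemma mode_weight_summable_iff:
  assumes "0 \<le> a"
  shows "mode_weight a b w summable_on UNIV \<longleftrightarrow> b < a"
  using mode_weight_summable[of b a w] mode_weight_not_summable[OF assms, of b w] by (meson not_less)

section \<open>Factorisation over several modes\<close>

text \<open>A finite set of functions lies in the box of its projections, over which the sum
  factorises; this bounds all finite partial sums.\<close>

lemma summable_on_prod_PiE:
  fixes h :: "'i \<Rightarrow> 'b \<Rightarrow> real"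
  assumes fin: "finite A" and h: "\<And>j. j \<in> A \<Longrightarrow> h j summable_on B j"
    and nonneg: "\<And>j x. j \<in> A \<Longrightarrow> x \<in> B j \<Longrightarrow> 0 \<le> h j x"
  shows "(\<lambda>g. \<Prod>j\<in>A. h j (g j)) summable_on Pi\<^sub>E A B"
proof (rule nonneg_bdd_above_summable_on)
  show "0 \<le> (\<Prod>j\<in>A. h j (g j))" if "g \<in> Pi\<^sub>E A B" for g
    using that nonneg by (auto intro!: prod_nonneg)
  have "(\<Sum>g\<in>F. \<Prod>j\<in>A. h j (g j)) \<le> (\<Prod>j\<in>A. infsum (h j) (B j))" if F: "F \<subseteq> Pi\<^sub>E A B" "finite F" for F
  proof -
    let ?P = "\<lambda>j. (\<lambda>g. g j) ` F"
    have "(\<Sum>g\<in>F. \<Prod>j\<in>A. h j (g j)) \<le> (\<Sum>g\<in>Pi\<^sub>E A ?P. \<Prod>j\<in>A. h j (g j))"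
    proof (rule sum_mono2)
      show "finite (Pi\<^sub>E A ?P)" using fin F by (intro finite_PiE) auto
      show "F \<subseteq> Pi\<^sub>E A ?P"
      proof
        fix g assume g: "g \<in> F"
        with F have "g \<in> Pi\<^sub>E A B" by blast
        then show "g \<in> Pi\<^sub>E A ?P" using g by (intro PiE_I) (auto intro: PiE_arb)
      qed
      show "0 \<le> (\<Prod>j\<in>A. h j (g j))" if "g \<in> Pi\<^sub>E A ?P - F" for g
      proof (rule prod_nonneg)
        fix j assume j: "j \<in> A"
        with that obtain g' where "g' \<in> F" "g j = g' j" by (blast dest: PiE_mem)
        then show "0 \<le> h j (g j)" using nonneg[OF j] PiE_mem[of g' A B j] F j by auto
      qed
    qed
    also have "\<dots> = (\<Prod>j\<in>A. \<Sum>x\<in>?P j. h j x)"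
      by (rule prod_sum_PiE[symmetric]) (use fin F in auto)
    also have "\<dots> \<le> (\<Prod>j\<in>A. infsum (h j) (B j))"
    proof (rule prod_mono, intro conjI)
      fix j assume j: "j \<in> A"
      have sub: "?P j \<subseteq> B j" using F j by (auto simp: PiE_iff)
      then show "0 \<le> (\<Sum>x\<in>?P j. h j x)" using nonneg j by (intro sum_nonneg) auto
      show "(\<Sum>x\<in>?P j. h j x) \<le> infsum (h j) (B j)"
        by (rule finite_sum_le_infsum[OF h[OF j] _ sub]) (use F nonneg j in auto)
    qed
    finally show ?thesis .
  qed
  then show "bdd_above (sum (\<lambda>g. \<Prod>j\<in>A. h j (g j)) ` {F. F \<subseteq> Pi\<^sub>E A B \<and> finite F})"
    by (auto intro!: bdd_aboveI2)
qed

lemma summable_on_prod_idx_iff: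
  fixes h :: "nat \<Rightarrow> nat \<times> nat \<Rightarrow> real"
  assumes nonneg: "\<And>j x. 0 \<le> h j x" and nz: "\<And>j. j < n \<Longrightarrow> h j (0, 0) \<noteq> 0"
  shows "(\<lambda>(k, m). \<Prod>j<n. h j (k j, m j)) summable_on idx n \<times> idx n \<longleftrightarrow> (\<forall>j<n. h j summable_on UNIV)"
    (is "?F summable_on _ \<longleftrightarrow> _")
proof (intro iffI allI impI)
  assume h: "\<forall>j<n. h j summable_on UNIV"
  \<comment> \<open>Turns a pair of multi-indices into a multi-index of pairs, the form in which the
    product splits.\<close>
  define \<phi> where "\<phi> = (\<lambda>(k :: nat \<Rightarrow> nat, m :: nat \<Rightarrow> nat). \<lambda>j\<in>{..<n}. (k j, m j))"
  have "(\<lambda>g. \<Prod>j<n. h j (g j)) summable_on (Pi\<^sub>E {..<n} (\<lambda>_. UNIV))"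
    using h nonneg by (intro summable_on_prod_PiE) auto
  then have "(\<lambda>g. \<Prod>j<n. h j (g j)) summable_on (\<phi> ` (idx n \<times> idx n))"
    by (rule summable_on_subset_banach) (auto simp: \<phi>_def split: if_splits)
  moreover have "inj_on \<phi> (idx n \<times> idx n)"
  proof (rule inj_onI, clarify, intro conjI)
    fix k m k' m' assume *: "k \<in> idx n" "m \<in> idx n" "k' \<in> idx n" "m' \<in> idx n" "\<phi> (k, m) = \<phi> (k', m')"
    have "k j = k' j \<and> m j = m' j" if "j < n" for j
      using fun_cong[OF *(5), of j] that by (simp add: \<phi>_def)
    then show "k = k'" "m = m'" using * unfolding idx_def by (auto intro: PiE_ext)
  qed
  ultimately have "((\<lambda>g. \<Prod>j<n. h j (g j)) \<circ> \<phi>) summable_on idx n \<times> idx n"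
    by (simp add: summable_on_reindex)
  then show "?F summable_on idx n \<times> idx n"
    by (rule summable_on_cong[THEN iffD1, rotated]) (auto simp: \<phi>_def)
next
  fix j assume F: "?F summable_on idx n \<times> idx n" and j: "j < n"
  \<comment> \<open>A slice: only mode \<open>j\<close> varies and the others stay at 0, where their
    factors are nonzero constants that can be divided out.\<close>
  define e :: "nat \<Rightarrow> nat \<Rightarrow> nat" where "e a = (\<lambda>i\<in>{..<n}. if i = j then a else 0)" for a
  have "?F summable_on ((\<lambda>(a, b). (e a, e b)) ` UNIV)"
    by (rule summable_on_subset_banach[OF F]) (auto simp: e_def idx_def split: if_splits)
  moreover have "inj (\<lambda>(a, b). (e a, e b))"
  proof (rule injI, clarify, intro conjI)
    fix a b a' b' assume "e a = e a'" "e b = e b'"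
    then have "e a j = e a' j" "e b j = e b' j" by simp_all
    then show "a = a'" "b = b'" using j by (simp_all add: e_def)
  qed
  ultimately have "(?F \<circ> (\<lambda>(a, b). (e a, e b))) summable_on UNIV"
    by (simp add: summable_on_reindex)
  also have "?F \<circ> (\<lambda>(a, b). (e a, e b)) = (\<lambda>x. (\<Prod>i\<in>{..<n} - {j}. h i (0, 0)) * h j x)"
  proof
    fix x
    have "(?F \<circ> (\<lambda>(a, b). (e a, e b))) x = (\<Prod>i<n. if i = j then h j x else h i (0, 0))"
      by (auto simp: e_def intro!: prod.cong split: prod.split)
    also have "\<dots> = (\<Prod>i\<in>{..<n} - {j}. h i (0, 0)) * h j x"
      using j by (subst prod.remove[of _ j]) (auto intro!: prod.cong)
    finally show "(?F \<circ> (\<lambda>(a, b). (e a, e b))) x = (\<Prod>i\<in>{..<n} - {j}. h i (0, 0)) * h j x" .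
  qed
  finally show "h j summable_on UNIV"
    using nz by (subst (asm) summable_on_cmult_right') (auto simp: prod_zero_iff)
qed

section \<open>The Petz--Renyi sum\<close>

text \<open>Absolute summability is what allows the sum over multi-indices to factorise in
  \<open>inner_n_weyl_ket\<close>.\<close>

lemma weyl_overlap:
  "(\<lambda>i. norm (cnj (weyl u (ket k) i) * weyl v (ket m) i)) summable_on UNIV"
  "infsum (\<lambda>i. cnj (weyl u (ket k) i) * weyl v (ket m) i) UNIV =
     complex_of_real (exp (- ((cmod u)\<^sup>2 / 2)) * exp (- ((cmod v)\<^sup>2 / 2))) * exp (cnj u * v)
       * disp (v - u) (- cnj (v - u)) m k"
proof -
  have s: "summable (\<lambda>i. norm (cnj (weyl_matrix u i k) * weyl_matrix v i m))"
    by (intro l2_mult_summable) (simp_all add: isometric_matrix_col[OF isometric_weyl_matrix])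
  then show "(\<lambda>i. norm (cnj (weyl u (ket k) i) * weyl v (ket m) i)) summable_on UNIV"
    unfolding weyl_ket_eq by (rule summable_nonneg_imp_summable_on) simp
  show "infsum (\<lambda>i. cnj (weyl u (ket k) i) * weyl v (ket m) i) UNIV =
     complex_of_real (exp (- ((cmod u)\<^sup>2 / 2)) * exp (- ((cmod v)\<^sup>2 / 2))) * exp (cnj u * v)
       * disp (v - u) (- cnj (v - u)) m k"
    unfolding weyl_ket_eq disp_swap[of "v - u"]
    by (rule infsumI[OF norm_summable_imp_has_sum[OF s weyl_matrix_pairing]])
qed

lemma inner_n_weyl_ket:
  "inner_n n (weyl_ket n u k) (weyl_ket n v m) =
     (\<Prod>j<n. infsum (\<lambda>i. cnj (weyl (u j) (ket (k j)) i) * weyl (v j) (ket (m j)) i) UNIV)"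
proof -
  have "inner_n n (weyl_ket n u k) (weyl_ket n v m) =
      infsum (\<lambda>g. \<Prod>j<n. cnj (weyl (u j) (ket (k j)) (g j)) * weyl (v j) (ket (m j)) (g j)) (Pi\<^sub>E {..<n} (\<lambda>_. UNIV))"
    by (simp add: inner_n_def weyl_ket_def tensor_def idx_def prod.distrib)
  also have "\<dots> = (\<Prod>j<n. infsum (\<lambda>i. cnj (weyl (u j) (ket (k j)) i) * weyl (v j) (ket (m j)) i) UNIV)"
    by (rule infsum_prod_PiE_abs) (auto intro: weyl_overlap(1))
  finally show ?thesis .
qed

text \<open>Everything in the summand of one mode that is independent of the number indices; its
  positivity keeps it from affecting convergence.\<close>

definition mode_const :: "real \<Rightarrow> real \<Rightarrow> real \<Rightarrow> complex \<Rightarrow> complex \<Rightarrow> real" where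
  "mode_const \<alpha> r s u v = (1 - exp (- r)) powr \<alpha> * (1 - exp (- s)) powr (1 - \<alpha>)
     * (cmod (complex_of_real (exp (- ((cmod u)\<^sup>2 / 2)) * exp (- ((cmod v)\<^sup>2 / 2))) * exp (cnj u * v)))\<^sup>2"

lemma mode_const_pos: "0 < r \<Longrightarrow> 0 < s \<Longrightarrow> 0 < mode_const \<alpha> r s u v"
  unfolding mode_const_def by (intro mult_pos_pos) (simp_all add: zero_less_power)

lemma petz_renyi_summand:
  assumes r: "\<And>j. j < n \<Longrightarrow> 0 < r j" and s: "\<And>j. j < n \<Longrightarrow> 0 < s j"
  shows "ennreal (thermal_eig n r k powr \<alpha>)
      * (if 1 < \<alpha> \<and> thermal_eig n s m = 0 then top else ennreal (thermal_eig n s m powr (1 - \<alpha>)))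
      * ennreal ((cmod (inner_n n (weyl_ket n u k) (weyl_ket n v m)))\<^sup>2)
    = ennreal (\<Prod>j<n. mode_const \<alpha> (r j) (s j) (u j) (v j) * mode_weight (\<alpha> * r j) ((\<alpha> - 1) * s j) (v j - u j) (k j, m j))"
    (is "?L = _")
proof -
  have powr: "((1 - exp (- t)) * exp (- real i * t)) powr \<beta> = (1 - exp (- t)) powr \<beta> * exp (- (\<beta> * t) * real i)" if "0 < t" for t i \<beta>
    using that by (simp add: powr_mult powr_def[of "exp _"] mult_ac)
  have eig: "thermal_eig n t i powr \<beta> = (\<Prod>j<n. (1 - exp (- t j)) powr \<beta> * exp (- (\<beta> * t j) * real (i j)))"
    if "\<And>j. j < n \<Longrightarrow> 0 < t j" for t i \<beta>
  proof -
    have "thermal_eig n t i powr \<beta> = (\<Prod>j<n. ((1 - exp (- t j)) * exp (- real (i j) * t j)) powr \<beta>)"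
      unfolding thermal_eig_def by (rule prod_powr_distrib)
    also have "\<dots> = (\<Prod>j<n. (1 - exp (- t j)) powr \<beta> * exp (- (\<beta> * t j) * real (i j)))"
      by (rule prod.cong[OF refl], rule powr) (simp add: that)
    finally show ?thesis .
  qed
  \<comment> \<open>Selects the real-valued branch of the \<open>if\<close>.\<close>
  have "thermal_eig n s m \<noteq> 0"
    using s by (auto simp: thermal_eig_def dest: s)
  then have "?L = ennreal (thermal_eig n r k powr \<alpha> * thermal_eig n s m powr (1 - \<alpha>)
      * (cmod (inner_n n (weyl_ket n u k) (weyl_ket n v m)))\<^sup>2)"
    by (simp add: ennreal_mult)
  also have "thermal_eig n r k powr \<alpha> * thermal_eig n s m powr (1 - \<alpha>)
      * (cmod (inner_n n (weyl_ket n u k) (weyl_ket n v m)))\<^sup>2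
    = (\<Prod>j<n. mode_const \<alpha> (r j) (s j) (u j) (v j) * mode_weight (\<alpha> * r j) ((\<alpha> - 1) * s j) (v j - u j) (k j, m j))"
  proof -
    have eig_r: "thermal_eig n r k powr \<alpha> = (\<Prod>j<n. (1 - exp (- r j)) powr \<alpha> * exp (- (\<alpha> * r j) * real (k j)))"
      by (rule eig) (rule r)
    have e: "- ((1 - \<alpha>) * s j) = (\<alpha> - 1) * s j" for j by (simp add: algebra_simps)
    have eig_s: "thermal_eig n s m powr (1 - \<alpha>) = (\<Prod>j<n. (1 - exp (- s j)) powr (1 - \<alpha>) * exp ((\<alpha> - 1) * s j * real (m j)))"
      unfolding e[symmetric] by (rule eig) (rule s)
    show ?thesis
      unfolding eig_r eig_s inner_n_weyl_ket weyl_overlap(2) prod_norm[symmetric] prod_power_distrib prod.distrib[symmetric]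
      by (rule prod.cong[OF refl])
         (simp only: mode_const_def mode_weight_def prod.case norm_mult power_mult_distrib mult_ac)
  qed
  finally show ?thesis .
qed

section \<open>Infinite values and the threshold\<close>

text \<open>Both sides are governed by the supremum of the finite partial sums.\<close>

lemma infsum_ennreal_eq_top_iff:
  assumes nonneg: "\<And>x. x \<in> A \<Longrightarrow> 0 \<le> f x"
  shows "infsum (\<lambda>x. ennreal (f x)) A = top \<longleftrightarrow> \<not> f summable_on A"
proof
  have SUP: "infsum (\<lambda>x. ennreal (f x)) A = (SUP F\<in>{F. finite F \<and> F \<subseteq> A}. \<Sum>x\<in>F. ennreal (f x))"
    by (rule nonneg_infsum_complete) simp
  have sum: "(\<Sum>x\<in>F. ennreal (f x)) = ennreal (sum f F)" if "F \<subseteq> A" for F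
    using nonneg that by (intro sum_ennreal) auto
  have eq: "infsum (\<lambda>x. ennreal (f x)) A = (SUP F\<in>{F. finite F \<and> F \<subseteq> A}. ennreal (sum f F))"
    unfolding SUP by (rule SUP_cong) (auto simp: sum)
  show "\<not> f summable_on A" if "infsum (\<lambda>x. ennreal (f x)) A = top"
    using that eq infsum_nonneg_is_SUPREMUM_ennreal[of f A] nonneg by (metis ennreal_neq_top)
  show "infsum (\<lambda>x. ennreal (f x)) A = top" if ns: "\<not> f summable_on A"
  proof (rule ccontr)
    assume nt: "infsum (\<lambda>x. ennreal (f x)) A \<noteq> top"
    have "f summable_on A"
    proof (rule nonneg_bdd_above_summable_on[OF nonneg])
      have "sum f F \<le> enn2real (infsum (\<lambda>x. ennreal (f x)) A)" if "F \<subseteq> A" "finite F" for F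
      proof -
        have "ennreal (sum f F) \<le> infsum (\<lambda>x. ennreal (f x)) A"
          unfolding eq using that by (intro SUP_upper) auto
        moreover have "0 \<le> sum f F" using nonneg that by (intro sum_nonneg) auto
        ultimately show ?thesis using enn2real_mono[of "ennreal (sum f F)"] nt by (simp add: less_top)
      qed
      then show "bdd_above (sum f ` {F. F \<subseteq> A \<and> finite F})" by (auto intro!: bdd_aboveI2)
    qed
    with ns show False by simp
  qed
qed

lemma infsum_ennreal_ne_0:
  fixes f :: "'a \<Rightarrow> ennreal"
  assumes "x \<in> A" "f x \<noteq> 0"
  shows "infsum f A \<noteq> 0"
proof -
  have "f x \<le> infsum f A"
    using infsum_mono_neutral[of f "{x}" f A] nonneg_summable_on_complete[of A f] assms by simp
  then show ?thesis using assms by auto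
qed

text \<open>For \<alpha> < 1 the factor is negative, so only a logarithm of minus infinity, that is
  \<open>x = 0\<close>, could give infinity; for \<alpha> > 1 only \<open>x = top\<close>
  does.\<close>

lemma eln_times_lt_top_iff:
  assumes "x \<noteq> 0" "\<alpha> \<noteq> 1"
  shows "eln x * ereal (1 / (\<alpha> - 1)) < \<infinity> \<longleftrightarrow> \<alpha> < 1 \<or> x \<noteq> top"
  using assms by (auto simp: eln_def)

text \<open>The left side says \<alpha> (s - r) < s, which is automatic when s \<le> r.\<close>

lemma less_threshold_iff:
  fixes \<alpha> r s :: real
  assumes "1 < \<alpha>" "0 < s"
  shows "(\<alpha> - 1) * s < \<alpha> * r \<longleftrightarrow> (r < s \<longrightarrow> \<alpha> < s / (s - r))"
proof (cases "r < s")
  case True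
  then show ?thesis by (auto simp: pos_less_divide_eq algebra_simps)
next
  case False
  then have "\<alpha> * s \<le> \<alpha> * r" using assms by (intro mult_left_mono) auto
  moreover have "(\<alpha> - 1) * s = \<alpha> * s - s" by (simp add: left_diff_distrib)
  ultimately have "(\<alpha> - 1) * s < \<alpha> * r" using assms by linarith
  then show ?thesis using False by simp
qed

text \<open>Over a nonempty finite set the infimum is attained, so strictness survives; over the
  empty set it is \<open>top\<close>.\<close>

lemma less_INF_finite_iff:
  fixes f :: "'a \<Rightarrow> 'b :: {complete_linorder}"
  assumes "finite A" "x < top"
  shows "x < (INF a\<in>A. f a) \<longleftrightarrow> (\<forall>a\<in>A. x < f a)"
proof (cases "A = {}")
  case False
  then have "(INF a\<in>A. f a) = Min (f ` A)" using assms by (intro cInf_eq_Min) auto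
  then show ?thesis using assms False by simp
qed (use assms in simp)

theorem theorem3p9:
  fixes n :: nat and r s :: "nat \<Rightarrow> real" and u1 u2 :: "nat \<Rightarrow> complex" and \<alpha> :: real
  assumes "n \<ge> 1"
    and "\<forall>j<n. 0 < r j" and "\<forall>j<n. 0 < s j"
    and "0 < \<alpha>" and "\<alpha> \<noteq> 1"
  shows "petz_renyi \<alpha> (idx n) (thermal_eig n r) (idx n) (thermal_eig n s)
            (\<lambda>k m. inner_n n (weyl_ket n u1 k) (weyl_ket n u2 m)) < \<infinity>
         \<longleftrightarrow> ereal \<alpha> < (INF j \<in> {j. j < n \<and> r j < s j}. ereal (s j / (s j - r j)))"
proof -
  define h where "h j x = mode_const \<alpha> (r j) (s j) (u1 j) (u2 j) *
    mode_weight (\<alpha> * r j) ((\<alpha> - 1) * s j) (u2 j - u1 j) x" for j x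
  \<comment> \<open>Extension by 0 makes nonnegativity hold at every index, as
    \<open>summable_on_prod_idx_iff\<close> demands.\<close>
  define h' where "h' j = (if j < n then h j else (\<lambda>_. 0))" for j
  have r: "\<And>j. j < n \<Longrightarrow> 0 < r j" and s: "\<And>j. j < n \<Longrightarrow> 0 < s j" using assms by auto
  have const: "0 < mode_const \<alpha> (r j) (s j) (u1 j) (u2 j)" if "j < n" for j
    using mode_const_pos r s that by blast
  have h'_nonneg: "0 \<le> h' j x" for j x
    using less_imp_le[OF const[of j]] by (cases "j < n") (simp_all add: h'_def h_def mode_weight_nonneg)
  have h'_00: "h' j (0, 0) \<noteq> 0" if "j < n" for j
    using const[OF that] that by (simp add: h'_def h_def mode_weight_def)
  define F where "F = (\<lambda>(k, m). \<Prod>j<n. h' j (k j, m j))"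
  define S where "S = infsum (\<lambda>x. ennreal (F x)) (idx n \<times> idx n)"
  have summand: "ennreal (thermal_eig n r k powr \<alpha>)
      * (if 1 < \<alpha> \<and> thermal_eig n s m = 0 then top else ennreal (thermal_eig n s m powr (1 - \<alpha>)))
      * ennreal ((cmod (inner_n n (weyl_ket n u1 k) (weyl_ket n u2 m)))\<^sup>2)
    = ennreal (\<Prod>j<n. h' j (k j, m j))" for k m
  proof -
    have "(\<Prod>j<n. mode_const \<alpha> (r j) (s j) (u1 j) (u2 j) *
        mode_weight (\<alpha> * r j) ((\<alpha> - 1) * s j) (u2 j - u1 j) (k j, m j)) = (\<Prod>j<n. h' j (k j, m j))"
      by (rule prod.cong) (simp_all add: h'_def h_def)
    then show ?thesis using petz_renyi_summand[of n r s k \<alpha> m u1 u2] r s by simp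
  qed
  have petz: "petz_renyi \<alpha> (idx n) (thermal_eig n r) (idx n) (thermal_eig n s)
            (\<lambda>k m. inner_n n (weyl_ket n u1 k) (weyl_ket n u2 m)) = eln S * ereal (1 / (\<alpha> - 1))"
    unfolding petz_renyi_def S_def F_def summand by (simp only: case_prod_unfold)
  \<comment> \<open>The vacuum term is positive, so \<open>S\<close> is nonzero and its logarithm is
    not minus infinity.\<close>
  let ?z = "\<lambda>j\<in>{..<n}. 0 :: nat"
  have "0 < (\<Prod>j<n. h' j (?z j, ?z j))"
    using h'_nonneg h'_00 by (intro prod_pos) (auto simp: less_le)
  then have S0: "S \<noteq> 0"
    unfolding S_def F_def by (intro infsum_ennreal_ne_0[of "(?z, ?z)"]) (auto simp: idx_def dest: h'_00)
  have "S = top \<longleftrightarrow> \<not> F summable_on (idx n \<times> idx n)"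
    unfolding S_def by (rule infsum_ennreal_eq_top_iff) (simp add: F_def prod_nonneg h'_nonneg split: prod.split)
  also have "F summable_on (idx n \<times> idx n) \<longleftrightarrow> (\<forall>j<n. h' j summable_on UNIV)"
    unfolding F_def by (rule summable_on_prod_idx_iff) (simp_all add: h'_nonneg h'_00)
  also have "(\<forall>j<n. h' j summable_on UNIV) \<longleftrightarrow> (\<forall>j<n. (\<alpha> - 1) * s j < \<alpha> * r j)"
  proof -
    have "h' j summable_on UNIV \<longleftrightarrow> (\<alpha> - 1) * s j < \<alpha> * r j" if j: "j < n" for j
    proof -
      have "h' j summable_on UNIV \<longleftrightarrow> mode_weight (\<alpha> * r j) ((\<alpha> - 1) * s j) (u2 j - u1 j) summable_on UNIV"
        unfolding h'_def h_def if_P[OF j] using const[OF j] by (intro summable_on_cmult_right') simp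
      also have "\<dots> \<longleftrightarrow> (\<alpha> - 1) * s j < \<alpha> * r j"
        using r[OF j] \<open>0 < \<alpha>\<close> by (intro mode_weight_summable_iff) simp
      finally show ?thesis .
    qed
    then show ?thesis by blast
  qed
  finally have S_top: "S \<noteq> top \<longleftrightarrow> (\<forall>j<n. (\<alpha> - 1) * s j < \<alpha> * r j)" by blast
  have "petz_renyi \<alpha> (idx n) (thermal_eig n r) (idx n) (thermal_eig n s)
            (\<lambda>k m. inner_n n (weyl_ket n u1 k) (weyl_ket n u2 m)) < \<infinity>
       \<longleftrightarrow> \<alpha> < 1 \<or> (\<forall>j<n. (\<alpha> - 1) * s j < \<alpha> * r j)"
    unfolding petz eln_times_lt_top_iff[OF S0 \<open>\<alpha> \<noteq> 1\<close>] S_top ..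
  also have "\<dots> \<longleftrightarrow> (\<forall>j<n. r j < s j \<longrightarrow> \<alpha> < s j / (s j - r j))"
  proof (cases "\<alpha> < 1")
    case True
    \<comment> \<open>Every threshold exceeds 1, so for \<alpha> < 1 both sides are true.\<close>
    have "\<alpha> < s j / (s j - r j)" if "j < n" "r j < s j" for j
    proof -
      have "1 < s j / (s j - r j)" using r[OF that(1)] that(2) by (simp add: pos_less_divide_eq)
      with True show ?thesis by linarith
    qed
    with True show ?thesis by blast
  next
    case False
    with assms less_threshold_iff show ?thesis by force
  qed
  also have "\<dots> \<longleftrightarrow> ereal \<alpha> < (INF j \<in> {j. j < n \<and> r j < s j}. ereal (s j / (s j - r j)))"
    by (subst less_INF_finite_iff) (auto simp: top_ereal_def)
  finally show ?thesis .
qed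

end
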